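(* Let $G$ be a non-trivial solvable group, let $A$ be a non-trivial abelian group with a $G$-module structure, and let $\delta\in Z^2(G,A)$. Put $U=[A,\gamma(G)]$. Then the extension $E_\delta$ of $A$ by $G$ via $\delta$ is a derived series extension if and only if the homomorphism $\kappa(\sigma(\delta)) : M(\gamma(G))\to A/U$ is surjective.
   Context: $G$ is written multiplicatively and $A$ additively; the (right) action of $g\in G$ on $a\in A$ is written $a^g$. $Z^2(G,A)$ is the group of normalized 2-cocycles $\delta : G\times G\to A$: $\delta(g,h)^k+\delta(gh,k)=\delta(h,k)+\delta(g,hk)$ and $\delta(g,1)=\delta(1,g)=0$ for all $g,h,k\in G$. The extension $E_\delta$ of $A$ by $G$ via $\delta$ is the set $G\times A$ with multiplication $(g,a)(g',a')=(gg',a^{g'}+a'+\delta(g,g'))$; $A$ embeds via $a\mapsto(1,a)$ with image $\overline{A}=\{(1,a)\mid a\in A\}$, and $E_\delta$ projects onto $G$ via $(g,a)\mapsto g$. An extension $E$ of $A$ by $G$, with image $\overline{A}$ of $A$ in $E$, is a derived series extension if $\overline{A}$ equals the smallest non-trivial term of the derived series of $E$. For a non-trivial solvable group $G$, $\gamma(G)$ denotes the smallest non-trivial term of the derived series of $G$; it is an abelian normal subgroup. $[A,\gamma(G)]$ is the subgroup of $A$ generated by all $a^g-a$ with $a\in A$, $g\in\gamma(G)$; it is a $G$-submodule, and $\gamma(G)$ acts trivially on $A/U$. The map $\sigma: Z^2(G,A)\to Z^2(\gamma(G),A/U)$ is defined by $\sigma(\delta)(g,h)=\delta(g,h)+U$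 for $g,h\in\gamma(G)$. Let $N=\gamma(G)$ (abelian). The non-abelian exterior product $N\wedge N$ is the group generated by symbols $g\wedge h$ ($g,h\in N$) subject to $gg'\wedge h=({}^g g'\wedge{}^g h)(g\wedge h)$, $g\wedge hh'=(g\wedge h)({}^h g\wedge{}^h h')$ and $h\wedge h=1$, where ${}^h g=hgh^{-1}$. The Schur multiplier $M(N)$ is the kernel of $N\wedge N\to[N,N]$, $g\wedge h\mapsto ghg^{-1}h^{-1}$; since $N$ is abelian, $M(N)=N\wedge N$ (the usual abelian exterior square). For $\epsilon\in Z^2(N,A/U)$ (trivial action), $\kappa(\epsilon):M(N)\to A/U$ is the group homomorphism determined by $g\wedge h\mapsto\epsilon(g,h)-\epsilon(h,g)$ for $g,h\in N$ (it is well defined). *)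

theory Defs
  imports "HOL-Algebra.Solvable_Groups"
begin

text \<open>
  A word over a set of generators is a list of pairs \<open>(x, b)\<close>, where \<open>b = True\<close> stands for
  the letter \<open>x\<close> and \<open>b = False\<close> for its formal inverse.
\<close>

type_synonym 'x word = "('x \<times> bool) list"

abbreviation words :: "'x set \<Rightarrow> 'x word set" where
  "words S \<equiv> lists (S \<times> UNIV)"

inductive_set pres_rel :: "'x set \<Rightarrow> ('x word \<times> 'x word) set \<Rightarrow> ('x word \<times> 'x word) set"
  for S R where
    refl: "w \<in> words S \<Longrightarrow> (w, w) \<in> pres_rel S R"
  | sym: "(u, v) \<in> pres_rel S R \<Longrightarrow> (v, u) \<in> pres_rel S R"
  | trans: "(u, v) \<in> pres_rel S R \<Longrightarrow> (v, w) \<in> pres_rel S R \<Longrightarrow> (u, w) \<in> pres_rel S R"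
  | mult: "(u, u') \<in> pres_rel S R \<Longrightarrow> (v, v') \<in> pres_rel S R \<Longrightarrow> (u @ v, u' @ v') \<in> pres_rel S R"
  | cancel: "x \<in> S \<Longrightarrow> ([(x, b), (x, \<not> b)], []) \<in> pres_rel S R"
  | rel: "(u, v) \<in> R \<Longrightarrow> u \<in> words S \<Longrightarrow> v \<in> words S \<Longrightarrow> (u, v) \<in> pres_rel S R"

definition presented_group :: "'x set \<Rightarrow> ('x word \<times> 'x word) set \<Rightarrow> 'x word set monoid" where
  "presented_group S R =
     \<lparr>carrier = words S // pres_rel S R,
      monoid.mult = (\<lambda>X Y. \<Union>x\<in>X. \<Union>y\<in>Y. pres_rel S R `` {x @ y}),
      one = pres_rel S R `` {[]}\<rparr>"

definition pres_gen :: "'x set \<Rightarrow> ('x word \<times> 'x word) set \<Rightarrow> 'x \<Rightarrow> 'x word set" where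
  "pres_gen S R x = pres_rel S R `` {[(x, True)]}"

primrec word_eval :: "('c, 'm) monoid_scheme \<Rightarrow> ('x \<Rightarrow> 'c) \<Rightarrow> 'x word \<Rightarrow> 'c" where
  "word_eval H f [] = \<one>\<^bsub>H\<^esub>"
| "word_eval H f (p # w) =
     (if snd p then f (fst p) else inv\<^bsub>H\<^esub> (f (fst p))) \<otimes>\<^bsub>H\<^esub> word_eval H f w"

text \<open>
  The homomorphism into \<open>H\<close> determined by its values \<open>f\<close> on the generators; it is well defined
  when the relators hold in \<open>H\<close>, see \<open>pres_lift_hom\<close>, \<open>pres_lift_gen\<close> and \<open>pres_hom_eqI\<close> below.
\<close>

definition pres_lift :: "('c, 'm) monoid_scheme \<Rightarrow> ('x \<Rightarrow> 'c) \<Rightarrow> 'x word set \<Rightarrow> 'c" where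
  "pres_lift H f X = the_elem (word_eval H f ` X)"

lemma pres_rel_words: "(u, v) \<in> pres_rel S R \<Longrightarrow> u \<in> words S \<and> v \<in> words S"
  by (induction rule: pres_rel.induct) auto

lemma equiv_pres_rel: "equiv (words S) (pres_rel S R)"
proof (rule equivI)
  show "pres_rel S R \<subseteq> words S \<times> words S"
    using pres_rel_words by fast
  show "refl_on (words S) (pres_rel S R)"
    using pres_rel.refl by (auto simp: refl_on_def)
  show "Relation.sym (pres_rel S R)"
    by (blast intro: symI pres_rel.sym)
  show "Relation.trans (pres_rel S R)"
    by (blast intro: transI pres_rel.trans)
qed

lemma pres_mult_class:
  assumes "u \<in> words S" "v \<in> words S"
  shows "(pres_rel S R `` {u}) \<otimes>\<^bsub>presented_group S R\<^esub> (pres_rel S R `` {v}) =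
         pres_rel S R `` {u @ v}"
proof -
  define U V C where "U = pres_rel S R `` {u}" and "V = pres_rel S R `` {v}"
    and "C = pres_rel S R `` {u @ v}"
  have *: "pres_rel S R `` {x @ y} = C" if "x \<in> U" "y \<in> V" for x y
    using that equiv_class_eq[OF equiv_pres_rel pres_rel.mult, of u x S R v y]
    unfolding U_def V_def C_def by blast
  have "u \<in> U" "v \<in> V"
    unfolding U_def V_def using assms by (blast intro: pres_rel.refl)+
  hence "(\<Union>x\<in>U. \<Union>y\<in>V. C) = C"
    by (metis UN_constant empty_iff)
  moreover have "(\<Union>x\<in>U. \<Union>y\<in>V. pres_rel S R `` {x @ y}) = (\<Union>x\<in>U. \<Union>y\<in>V. C)"
    by (intro SUP_cong HOL.refl) (rule *)
  ultimately have "(\<Union>x\<in>U. \<Union>y\<in>V. pres_rel S R `` {x @ y}) = C"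
    by simp
  hence "(\<Union>x\<in>pres_rel S R `` {u}. \<Union>y\<in>pres_rel S R `` {v}. pres_rel S R `` {x @ y}) =
         pres_rel S R `` {u @ v}"
    unfolding U_def V_def C_def .
  thus ?thesis
    by (simp add: presented_group_def)
qed

lemma pres_carrierE:
  assumes "X \<in> carrier (presented_group S R)"
  obtains w where "w \<in> words S" "X = pres_rel S R `` {w}"
  using assms by (auto simp: presented_group_def elim!: quotientE)

lemma pres_class_closed:
  "w \<in> words S \<Longrightarrow> pres_rel S R `` {w} \<in> carrier (presented_group S R)"
  by (auto simp: presented_group_def intro: quotientI)

lemma pres_one: "\<one>\<^bsub>presented_group S R\<^esub> = pres_rel S R `` {[]}"
  by (simp add: presented_group_def)

lemma pres_word_inverse:
  assumes "w \<in> words S"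
  shows "\<exists>v\<in>words S. (v @ w, []) \<in> pres_rel S R"
  using assms
proof (induction w rule: list.induct)
  case Nil
  thus ?case by (auto intro!: pres_rel.refl bexI[of _ "[]"])
next
  case (Cons p w)
  then obtain v where v: "v \<in> words S" "(v @ w, []) \<in> pres_rel S R" by auto
  obtain x b where p0: "p = (x, b)" by (cases p)
  hence p: "p = (x, b)" "x \<in> S" using Cons.prems by auto
  have w: "w \<in> words S" using Cons.prems by auto
  have c: "([(x, \<not> b), (x, b)], []) \<in> pres_rel S R"
    using pres_rel.cancel[OF p(2), of "\<not> b"] by simp
  have "(v @ [(x, \<not> b), (x, b)] @ w, v @ [] @ w) \<in> pres_rel S R"
    using v(1) w by (intro pres_rel.mult c pres_rel.refl)
  hence "((v @ [(x, \<not> b)]) @ p # w, []) \<in> pres_rel S R"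
    using v p by (auto intro: pres_rel.trans)
  thus ?case using v p by (intro bexI[of _ "v @ [(x, \<not> b)]"]) auto
qed

lemma group_presented_group: "group (presented_group S R)"
proof (rule groupI)
  fix X Y Z
  assume "X \<in> carrier (presented_group S R)" "Y \<in> carrier (presented_group S R)"
  then obtain u v where uv: "u \<in> words S" "X = pres_rel S R `` {u}"
      "v \<in> words S" "Y = pres_rel S R `` {v}"
    by (metis pres_carrierE)
  thus "X \<otimes>\<^bsub>presented_group S R\<^esub> Y \<in> carrier (presented_group S R)"
    by (simp add: pres_mult_class pres_class_closed)
  assume "Z \<in> carrier (presented_group S R)"
  then obtain w where "w \<in> words S" "Z = pres_rel S R `` {w}"
    by (metis pres_carrierE)
  with uv show "X \<otimes>\<^bsub>presented_group S R\<^esub> Y \<otimes>\<^bsub>presented_group S R\<^esub> Z =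
      X \<otimes>\<^bsub>presented_group S R\<^esub> (Y \<otimes>\<^bsub>presented_group S R\<^esub> Z)"
    by (simp add: pres_mult_class)
next
  show "\<one>\<^bsub>presented_group S R\<^esub> \<in> carrier (presented_group S R)"
    by (simp add: pres_one pres_class_closed)
next
  fix X assume "X \<in> carrier (presented_group S R)"
  then obtain u where u: "u \<in> words S" "X = pres_rel S R `` {u}"
    by (metis pres_carrierE)
  thus "\<one>\<^bsub>presented_group S R\<^esub> \<otimes>\<^bsub>presented_group S R\<^esub> X = X"
    by (simp add: pres_one pres_mult_class)
  obtain v where v: "v \<in> words S" "(v @ u, []) \<in> pres_rel S R"
    using pres_word_inverse u by blast
  have "(pres_rel S R `` {v}) \<otimes>\<^bsub>presented_group S R\<^esub> X = \<one>\<^bsub>presented_group S R\<^esub>"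
    unfolding u(2) pres_mult_class[OF v(1) u(1)] pres_one
    by (rule equiv_class_eq[OF equiv_pres_rel v(2)])
  thus "\<exists>Y\<in>carrier (presented_group S R). Y \<otimes>\<^bsub>presented_group S R\<^esub> X = \<one>\<^bsub>presented_group S R\<^esub>"
    by (rule bexI) (rule pres_class_closed[OF v(1)])
qed

lemma pres_gen_closed: "x \<in> S \<Longrightarrow> pres_gen S R x \<in> carrier (presented_group S R)"
  by (simp add: pres_gen_def pres_class_closed)

lemma word_eval_closed:
  assumes "group H" "f \<in> S \<rightarrow> carrier H" "w \<in> words S"
  shows "word_eval H f w \<in> carrier H"
proof -
  interpret H: group H by fact
  show ?thesis using assms(3)
  proof (induction w rule: list.induct)
    case (Cons p w)
    have "fst p \<in> S" using Cons.prems by (cases p) simp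
    hence "f (fst p) \<in> carrier H" using assms(2) by blast
    moreover have "word_eval H f w \<in> carrier H" using Cons by simp
    ultimately show ?case by simp
  qed simp
qed

lemma word_eval_append:
  assumes "group H" "f \<in> S \<rightarrow> carrier H" "u \<in> words S" "v \<in> words S"
  shows "word_eval H f (u @ v) = word_eval H f u \<otimes>\<^bsub>H\<^esub> word_eval H f v"
proof -
  interpret H: group H by fact
  have v: "word_eval H f v \<in> carrier H" by (rule word_eval_closed[OF assms(1,2,4)])
  show ?thesis using assms(3)
  proof (induction u rule: list.induct)
    case (Cons p u)
    have "fst p \<in> S" using Cons.prems by (cases p) simp
    hence "f (fst p) \<in> carrier H" using assms(2) by blast
    moreover have "u \<in> words S" using Cons.prems by simp
    moreover from this have "word_eval H f u \<in> carrier H"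
      by (rule word_eval_closed[OF assms(1,2)])
    ultimately show ?case using Cons.IH v by (simp add: H.m_assoc)
  qed (use v in simp)
qed

lemma word_eval_cong:
  assumes "group H" "f \<in> S \<rightarrow> carrier H"
    and R: "\<And>u v. (u, v) \<in> R \<Longrightarrow> word_eval H f u = word_eval H f v"
    and "(u, v) \<in> pres_rel S R"
  shows "word_eval H f u = word_eval H f v"
proof -
  interpret H: group H by fact
  show ?thesis using assms(4)
  proof (induction rule: pres_rel.induct)
    case (mult u u' v v')
    thus ?case by (simp add: word_eval_append[OF assms(1,2)] pres_rel_words)
  next
    case (cancel x b)
    hence "f x \<in> carrier H" using assms(2) by auto
    thus ?case by simp
  qed (use R in auto)
qed

lemma pres_lift_class:
  assumes "group H" "f \<in> S \<rightarrow> carrier H"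
    and "\<And>u v. (u, v) \<in> R \<Longrightarrow> word_eval H f u = word_eval H f v"
    and w: "w \<in> words S"
  shows "pres_lift H f (pres_rel S R `` {w}) = word_eval H f w"
proof -
  have "word_eval H f ` (pres_rel S R `` {w}) = {word_eval H f w}"
    using word_eval_cong[OF assms(1-3)] pres_rel.refl[OF w] by fastforce
  thus ?thesis by (simp add: pres_lift_def)
qed

lemma pres_lift_hom:
  assumes "group H" "f \<in> S \<rightarrow> carrier H"
    and "\<And>u v. (u, v) \<in> R \<Longrightarrow> word_eval H f u = word_eval H f v"
  shows "pres_lift H f \<in> hom (presented_group S R) H"
proof (rule homI)
  note [simp] = pres_lift_class[OF assms]
  fix X assume "X \<in> carrier (presented_group S R)"
  then obtain u where u: "u \<in> words S" "X = pres_rel S R `` {u}"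
    by (metis pres_carrierE)
  thus "pres_lift H f X \<in> carrier H"
    by (simp add: word_eval_closed[OF assms(1,2)])
  fix Y assume "Y \<in> carrier (presented_group S R)"
  then obtain v where "v \<in> words S" "Y = pres_rel S R `` {v}"
    by (metis pres_carrierE)
  thus "pres_lift H f (X \<otimes>\<^bsub>presented_group S R\<^esub> Y) = pres_lift H f X \<otimes>\<^bsub>H\<^esub> pres_lift H f Y"
    using u by (simp add: pres_mult_class word_eval_append[OF assms(1,2)])
qed

lemma pres_lift_gen:
  assumes "group H" "f \<in> S \<rightarrow> carrier H"
    and "\<And>u v. (u, v) \<in> R \<Longrightarrow> word_eval H f u = word_eval H f v"
    and "x \<in> S"
  shows "pres_lift H f (pres_gen S R x) = f x"
proof -
  interpret H: group H by fact
  have "f x \<in> carrier H" using assms(2,4) by blast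
  thus ?thesis using pres_lift_class[OF assms(1-3), where w = "[(x, True)]"] assms(4)
    by (simp add: pres_gen_def)
qed

lemma pres_hom_eqI:
  assumes "group H" "p \<in> hom (presented_group S R) H" "q \<in> hom (presented_group S R) H"
    and gen: "\<And>x. x \<in> S \<Longrightarrow> p (pres_gen S R x) = q (pres_gen S R x)"
    and "X \<in> carrier (presented_group S R)"
  shows "p X = q X"
proof -
  let ?P = "presented_group S R"
  interpret P: group ?P by (rule group_presented_group)
  interpret p: group_hom ?P H p
    using assms by (simp add: group_hom_def group_hom_axioms_def P.group_axioms)
  interpret q: group_hom ?P H q
    using assms by (simp add: group_hom_def group_hom_axioms_def P.group_axioms)
  have letter: "p (pres_rel S R `` {[(x, b)]}) = q (pres_rel S R `` {[(x, b)]})" if x: "x \<in> S" for x b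
  proof (cases b)
    case True thus ?thesis using gen[OF x] by (simp add: pres_gen_def)
  next
    case False
    have c: "pres_rel S R `` {[(x, False)]} \<in> carrier ?P" using x by (simp add: pres_class_closed)
    have "pres_rel S R `` {[(x, False)]} \<otimes>\<^bsub>?P\<^esub> pres_gen S R x = \<one>\<^bsub>?P\<^esub>"
      using x equiv_class_eq[OF equiv_pres_rel pres_rel.cancel[OF x, of False R]]
      by (simp add: pres_gen_def pres_mult_class pres_one)
    hence "pres_rel S R `` {[(x, False)]} = inv\<^bsub>?P\<^esub> pres_gen S R x"
      using P.inv_equality[OF _ pres_gen_closed[OF x] c] by simp
    thus ?thesis using False gen[OF x] x by (simp add: pres_gen_closed)
  qed
  obtain w where w: "w \<in> words S" "X = pres_rel S R `` {w}"
    using assms(5) by (metis pres_carrierE)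
  have "p (pres_rel S R `` {w}) = q (pres_rel S R `` {w})" using w(1)
  proof (induction w rule: list.induct)
    case Nil
    show ?case using p.hom_one q.hom_one by (simp add: pres_one)
  next
    case (Cons l w)
    obtain x b where l0: "l = (x, b)" by (cases l)
    hence l: "l = (x, b)" "x \<in> S" using Cons.prems by auto
    have w: "w \<in> words S" using Cons.prems by auto
    have "pres_rel S R `` {l # w} =
        (pres_rel S R `` {[(x, b)]}) \<otimes>\<^bsub>?P\<^esub> (pres_rel S R `` {w})"
      using l w by (simp add: pres_mult_class)
    thus ?case using l w Cons.IH letter by (simp add: pres_class_closed)
  qed
  thus ?thesis using w by simp
qed

definition ext_square_rels :: "('a, 'm) monoid_scheme \<Rightarrow> (('a \<times> 'a) word \<times> ('a \<times> 'a) word) set" where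
  "ext_square_rels N =
     {([((g \<otimes>\<^bsub>N\<^esub> g', h), True)],
       [((g \<otimes>\<^bsub>N\<^esub> g' \<otimes>\<^bsub>N\<^esub> inv\<^bsub>N\<^esub> g, g \<otimes>\<^bsub>N\<^esub> h \<otimes>\<^bsub>N\<^esub> inv\<^bsub>N\<^esub> g), True), ((g, h), True)])
      | g g' h. g \<in> carrier N \<and> g' \<in> carrier N \<and> h \<in> carrier N} \<union>
     {([((g, h \<otimes>\<^bsub>N\<^esub> h'), True)],
       [((g, h), True), ((h \<otimes>\<^bsub>N\<^esub> g \<otimes>\<^bsub>N\<^esub> inv\<^bsub>N\<^esub> h, h \<otimes>\<^bsub>N\<^esub> h' \<otimes>\<^bsub>N\<^esub> inv\<^bsub>N\<^esub> h), True)])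
      | g h h'. g \<in> carrier N \<and> h \<in> carrier N \<and> h' \<in> carrier N} \<union>
     {([((h, h), True)], []) | h. h \<in> carrier N}"

definition ext_square :: "('a, 'm) monoid_scheme \<Rightarrow> ('a \<times> 'a) word set monoid" where
  "ext_square N = presented_group (carrier N \<times> carrier N) (ext_square_rels N)"

definition wedge :: "('a, 'm) monoid_scheme \<Rightarrow> 'a \<Rightarrow> 'a \<Rightarrow> ('a \<times> 'a) word set" where
  "wedge N g h = pres_gen (carrier N \<times> carrier N) (ext_square_rels N) (g, h)"

definition derived_subgroup :: "('a, 'm) monoid_scheme \<Rightarrow> ('a, 'm) monoid_scheme" where
  "derived_subgroup N = N\<lparr>carrier := derived N (carrier N)\<rparr>"

definition commutator_map :: "('a, 'm) monoid_scheme \<Rightarrow> ('a \<times> 'a) word set \<Rightarrow> 'a" where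
  "commutator_map N =
     pres_lift (derived_subgroup N) (\<lambda>(g, h). g \<otimes>\<^bsub>N\<^esub> h \<otimes>\<^bsub>N\<^esub> inv\<^bsub>N\<^esub> g \<otimes>\<^bsub>N\<^esub> inv\<^bsub>N\<^esub> h)"

definition schur_multiplier :: "('a, 'm) monoid_scheme \<Rightarrow> ('a \<times> 'a) word set monoid" where
  "schur_multiplier N =
     (ext_square N)\<lparr>carrier := kernel (ext_square N) (derived_subgroup N) (commutator_map N)\<rparr>"

text \<open>
  Modules are written multiplicatively: \<open>act a g\<close> is the right action, and \<open>\<otimes>\<^bsub>A\<^esub>\<close> plays the role
  of the addition of the module.
\<close>

locale right_module = group G + A: comm_group A
  for G :: "('a, 'm) monoid_scheme" (structure) and A :: "('b, 'n) monoid_scheme" and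
    act :: "'b \<Rightarrow> 'a \<Rightarrow> 'b" +
  assumes act_closed: "\<lbrakk>a \<in> carrier A; g \<in> carrier G\<rbrakk> \<Longrightarrow> act a g \<in> carrier A"
    and act_mult: "\<lbrakk>a \<in> carrier A; b \<in> carrier A; g \<in> carrier G\<rbrakk>
      \<Longrightarrow> act (a \<otimes>\<^bsub>A\<^esub> b) g = act a g \<otimes>\<^bsub>A\<^esub> act b g"
    and act_one: "a \<in> carrier A \<Longrightarrow> act a \<one> = a"
    and act_act: "\<lbrakk>a \<in> carrier A; g \<in> carrier G; h \<in> carrier G\<rbrakk>
      \<Longrightarrow> act a (g \<otimes> h) = act (act a g) h"

definition cocycles2 ::
    "('a, 'm) monoid_scheme \<Rightarrow> ('b, 'n) monoid_scheme \<Rightarrow> ('b \<Rightarrow> 'a \<Rightarrow> 'b) \<Rightarrow> ('a \<Rightarrow> 'a \<Rightarrow> 'b) set" where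
  "cocycles2 G A act = {\<delta>.
     (\<forall>g\<in>carrier G. \<forall>h\<in>carrier G. \<delta> g h \<in> carrier A) \<and>
     (\<forall>g\<in>carrier G. \<forall>h\<in>carrier G. \<forall>k\<in>carrier G.
        act (\<delta> g h) k \<otimes>\<^bsub>A\<^esub> \<delta> (g \<otimes>\<^bsub>G\<^esub> h) k = \<delta> h k \<otimes>\<^bsub>A\<^esub> \<delta> g (h \<otimes>\<^bsub>G\<^esub> k)) \<and>
     (\<forall>g\<in>carrier G. \<delta> g \<one>\<^bsub>G\<^esub> = \<one>\<^bsub>A\<^esub> \<and> \<delta> \<one>\<^bsub>G\<^esub> g = \<one>\<^bsub>A\<^esub>)}"

definition extension ::
    "('a, 'm) monoid_scheme \<Rightarrow> ('b, 'n) monoid_scheme \<Rightarrow> ('b \<Rightarrow> 'a \<Rightarrow> 'b) \<Rightarrow> ('a \<Rightarrow> 'a \<Rightarrow> 'b)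
      \<Rightarrow> ('a \<times> 'b) monoid" where
  "extension G A act \<delta> =
     \<lparr>carrier = carrier G \<times> carrier A,
      monoid.mult = (\<lambda>(g, a) (g', a'). (g \<otimes>\<^bsub>G\<^esub> g', act a g' \<otimes>\<^bsub>A\<^esub> a' \<otimes>\<^bsub>A\<^esub> \<delta> g g')),
      one = (\<one>\<^bsub>G\<^esub>, \<one>\<^bsub>A\<^esub>)\<rparr>"

definition extension_kernel ::
    "('a, 'm) monoid_scheme \<Rightarrow> ('b, 'n) monoid_scheme \<Rightarrow> ('a \<times> 'b) set" where
  "extension_kernel G A = {(\<one>\<^bsub>G\<^esub>, a) | a. a \<in> carrier A}"

definition nontrivial_derived_terms :: "('a, 'm) monoid_scheme \<Rightarrow> 'a set set" where
  "nontrivial_derived_terms G = {(derived G ^^ n) (carrier G) | n. True} - {{\<one>\<^bsub>G\<^esub>}}"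

definition is_smallest_derived_term :: "('a, 'm) monoid_scheme \<Rightarrow> 'a set \<Rightarrow> bool" where
  "is_smallest_derived_term G K \<longleftrightarrow>
     K \<in> nontrivial_derived_terms G \<and> (\<forall>L\<in>nontrivial_derived_terms G. K \<subseteq> L)"

text \<open>
  Only meaningful when a smallest non-trivial term exists, as it does for non-trivial solvable
  groups (\<open>is_smallest_derived_term_gamma\<close> below).
\<close>

definition gamma :: "('a, 'm) monoid_scheme \<Rightarrow> 'a set" where
  "gamma G = (THE K. is_smallest_derived_term G K)"

definition gamma_group :: "('a, 'm) monoid_scheme \<Rightarrow> ('a, 'm) monoid_scheme" where
  "gamma_group G = G\<lparr>carrier := gamma G\<rparr>"

definition derived_series_extension ::
    "('a, 'm) monoid_scheme \<Rightarrow> ('b, 'n) monoid_scheme \<Rightarrow> ('b \<Rightarrow> 'a \<Rightarrow> 'b) \<Rightarrow> ('a \<Rightarrow> 'a \<Rightarrow> 'b) \<Rightarrow> bool"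
  where
  "derived_series_extension G A act \<delta> \<longleftrightarrow>
     is_smallest_derived_term (extension G A act \<delta>) (extension_kernel G A)"

definition module_commutator ::
    "('b, 'n) monoid_scheme \<Rightarrow> ('b \<Rightarrow> 'a \<Rightarrow> 'b) \<Rightarrow> 'a set \<Rightarrow> 'b set" where
  "module_commutator A act K =
     generate A {act a g \<otimes>\<^bsub>A\<^esub> inv\<^bsub>A\<^esub> a | a g. a \<in> carrier A \<and> g \<in> K}"

definition sigma ::
    "('b, 'n) monoid_scheme \<Rightarrow> 'b set \<Rightarrow> ('a \<Rightarrow> 'a \<Rightarrow> 'b) \<Rightarrow> 'a \<Rightarrow> 'a \<Rightarrow> 'b set" where
  "sigma A U \<delta> = (\<lambda>g h. U #>\<^bsub>A\<^esub> \<delta> g h)"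

text \<open>
  For abelian \<open>N\<close> the Schur multiplier is all of \<open>N \<and> N\<close>, and \<open>kappa N B \<epsilon>\<close> is the unique
  homomorphism on it with the stated values on the symbols \<open>g \<and> h\<close>: see
  \<open>schur_multiplier_comm_group\<close>, \<open>kappa_hom\<close> and \<open>kappa_unique\<close> below.
\<close>

definition kappa ::
    "('a, 'm) monoid_scheme \<Rightarrow> ('c, 'n) monoid_scheme \<Rightarrow> ('a \<Rightarrow> 'a \<Rightarrow> 'c) \<Rightarrow> ('a \<times> 'a) word set \<Rightarrow> 'c"
  where
  "kappa N B \<epsilon> =
     restrict (pres_lift B (\<lambda>(g, h). \<epsilon> g h \<otimes>\<^bsub>B\<^esub> inv\<^bsub>B\<^esub> \<epsilon> h g)) (carrier (schur_multiplier N))"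

lemma is_smallest_derived_term_unique:
  "is_smallest_derived_term G K \<Longrightarrow> is_smallest_derived_term G L \<Longrightarrow> K = L"
  by (auto simp: is_smallest_derived_term_def)

lemma is_smallest_derived_term_gamma:
  assumes "group G" "solvable G" "carrier G \<noteq> {\<one>\<^bsub>G\<^esub>}"
  shows "is_smallest_derived_term G (gamma G)"
proof -
  interpret group G by fact
  let ?D = "\<lambda>n. (derived G ^^ n) (carrier G)"
  have ex: "\<exists>n. ?D n = {\<one>\<^bsub>G\<^esub>}" using assms(2) by (simp add: solvable_iff_trivial_derived_seq)
  define m where "m = (LEAST n. ?D n = {\<one>\<^bsub>G\<^esub>})"
  have m: "?D m = {\<one>\<^bsub>G\<^esub>}" unfolding m_def by (rule LeastI_ex[OF ex])
  have "m \<noteq> 0" using m assms(3) by (cases m) auto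
  then obtain k where k: "m = Suc k" using not0_implies_Suc by blast
  have sub: "subgroup (?D n) G" for n by (rule exp_of_derived_is_subgroup[OF subgroup_self])
  have "?D (Suc n) \<subseteq> ?D n" for n using derived_incl[OF order.refl sub[of n]] by simp
  hence anti: "?D j \<subseteq> ?D i" if "i \<le> j" for i j using that by (rule lift_Suc_antimono_le)
  have nk: "?D k \<noteq> {\<one>\<^bsub>G\<^esub>}" using not_less_Least[of k "\<lambda>n. ?D n = {\<one>\<^bsub>G\<^esub>}"] k m_def by simp
  have "?D k \<subseteq> ?D n" if "?D n \<noteq> {\<one>\<^bsub>G\<^esub>}" for n
  proof -
    have "n \<le> k"
    proof (rule ccontr)
      assume "\<not> n \<le> k"
      hence "?D n \<subseteq> {\<one>\<^bsub>G\<^esub>}" using anti[of m n] m k by simp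
      moreover have "\<one>\<^bsub>G\<^esub> \<in> ?D n" by (rule subgroup.one_closed[OF sub])
      ultimately show False using that by blast
    qed
    thus ?thesis by (rule anti)
  qed
  hence sm: "is_smallest_derived_term G (?D k)"
    using nk unfolding is_smallest_derived_term_def nontrivial_derived_terms_def by blast
  show ?thesis unfolding gamma_def
    by (rule theI[of _ "?D k"]) (use sm is_smallest_derived_term_unique in blast)+
qed

lemma comm_group_gamma_group:
  assumes "group G" "solvable G" "carrier G \<noteq> {\<one>\<^bsub>G\<^esub>}"
  shows "subgroup (gamma G) G" and "comm_group (gamma_group G)"
proof -
  interpret group G by fact
  have sm: "is_smallest_derived_term G (gamma G)" by (rule is_smallest_derived_term_gamma[OF assms])
  then obtain n where n: "gamma G = (derived G ^^ n) (carrier G)" "gamma G \<noteq> {\<one>\<^bsub>G\<^esub>}"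
    unfolding is_smallest_derived_term_def nontrivial_derived_terms_def by auto
  show sub: "subgroup (gamma G) G"
    unfolding n(1) by (rule exp_of_derived_is_subgroup[OF subgroup_self])
  obtain t where t: "(derived G ^^ t) (carrier G) = {\<one>\<^bsub>G\<^esub>}"
    using assms(2) by (auto simp: solvable_iff_trivial_derived_seq)
  have triv: "derived G (gamma G) = {\<one>\<^bsub>G\<^esub>}"
  proof (rule ccontr)
    assume ne: "derived G (gamma G) \<noteq> {\<one>\<^bsub>G\<^esub>}"
    moreover have "derived G (gamma G) = (derived G ^^ Suc n) (carrier G)" using n by simp
    ultimately have "derived G (gamma G) \<in> nontrivial_derived_terms G"
      unfolding nontrivial_derived_terms_def by blast
    hence "gamma G \<subseteq> derived G (gamma G)" using sm unfolding is_smallest_derived_term_def by blast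
    hence stable: "derived G (gamma G) = gamma G" using derived_incl[OF order.refl sub] by blast
    have "(derived G ^^ j) (gamma G) = gamma G" for j by (induction j) (simp_all add: stable)
    moreover have "(derived G ^^ t) (gamma G) \<subseteq> {\<one>\<^bsub>G\<^esub>}"
      using mono_exp_of_derived[OF subgroup.subset[OF sub], of t] t by simp
    ultimately have "gamma G \<subseteq> {\<one>\<^bsub>G\<^esub>}" by simp
    moreover have "\<one>\<^bsub>G\<^esub> \<in> gamma G" by (rule subgroup.one_closed[OF sub])
    ultimately show False using n(2) by blast
  qed
  have "x \<otimes>\<^bsub>G\<^esub> y = y \<otimes>\<^bsub>G\<^esub> x" if xy: "x \<in> gamma G" "y \<in> gamma G" for x y
  proof -
    have c: "x \<in> carrier G" "y \<in> carrier G" using xy subgroup.subset[OF sub] by auto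
    have "x \<otimes>\<^bsub>G\<^esub> y \<otimes>\<^bsub>G\<^esub> inv\<^bsub>G\<^esub> x \<otimes>\<^bsub>G\<^esub> inv\<^bsub>G\<^esub> y \<in> derived G (gamma G)"
      unfolding derived_def by (rule generate.incl) (use xy in auto)
    hence "x \<otimes>\<^bsub>G\<^esub> y \<otimes>\<^bsub>G\<^esub> inv\<^bsub>G\<^esub> x \<otimes>\<^bsub>G\<^esub> inv\<^bsub>G\<^esub> y = \<one>\<^bsub>G\<^esub>" using triv by simp
    hence "x \<otimes>\<^bsub>G\<^esub> y \<otimes>\<^bsub>G\<^esub> inv\<^bsub>G\<^esub> (y \<otimes>\<^bsub>G\<^esub> x) = \<one>\<^bsub>G\<^esub>" using c by (simp add: inv_mult_group m_assoc)
    thus ?thesis using c by (metis inv_closed inv_equality inv_inv m_closed)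
  qed
  thus "comm_group (gamma_group G)"
    unfolding gamma_group_def
    by (intro group.group_comm_groupI subgroup.subgroup_is_group[OF sub] assms(1)) simp
qed

lemma commutator_map_hom:
  assumes "group N"
  shows "commutator_map N \<in> hom (ext_square N) (derived_subgroup N)"
    and "\<lbrakk>g \<in> carrier N; h \<in> carrier N\<rbrakk> \<Longrightarrow>
      commutator_map N (wedge N g h) = g \<otimes>\<^bsub>N\<^esub> h \<otimes>\<^bsub>N\<^esub> inv\<^bsub>N\<^esub> g \<otimes>\<^bsub>N\<^esub> inv\<^bsub>N\<^esub> h"
proof -
  interpret N: group N by fact
  let ?c = "\<lambda>(g, h). g \<otimes>\<^bsub>N\<^esub> h \<otimes>\<^bsub>N\<^esub> inv\<^bsub>N\<^esub> g \<otimes>\<^bsub>N\<^esub> inv\<^bsub>N\<^esub> h"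
  have sub: "subgroup (derived N (carrier N)) N"
    by (rule N.derived_is_subgroup) simp
  have H: "group (derived_subgroup N)"
    unfolding derived_subgroup_def by (rule subgroup.subgroup_is_group[OF sub assms])
  have f: "?c \<in> carrier N \<times> carrier N \<rightarrow> carrier (derived_subgroup N)"
  proof (rule Pi_I)
    fix p assume "p \<in> carrier N \<times> carrier N"
    thus "?c p \<in> carrier (derived_subgroup N)"
      unfolding derived_subgroup_def derived_def by (force intro!: generate.incl)
  qed
  have canc: "inv\<^bsub>N\<^esub> x \<otimes>\<^bsub>N\<^esub> (x \<otimes>\<^bsub>N\<^esub> y) = y" "x \<otimes>\<^bsub>N\<^esub> (inv\<^bsub>N\<^esub> x \<otimes>\<^bsub>N\<^esub> y) = y"
    if "x \<in> carrier N" "y \<in> carrier N" for x y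
    using that by (simp_all add: N.m_assoc[symmetric])
  have R: "word_eval (derived_subgroup N) ?c u = word_eval (derived_subgroup N) ?c v"
    if "(u, v) \<in> ext_square_rels N" for u v
    using that unfolding ext_square_rels_def derived_subgroup_def
    by (auto simp: N.m_assoc N.inv_mult_group canc)
  show "commutator_map N \<in> hom (ext_square N) (derived_subgroup N)"
    unfolding commutator_map_def ext_square_def by (rule pres_lift_hom[OF H f R])
  show "commutator_map N (wedge N g h) = g \<otimes>\<^bsub>N\<^esub> h \<otimes>\<^bsub>N\<^esub> inv\<^bsub>N\<^esub> g \<otimes>\<^bsub>N\<^esub> inv\<^bsub>N\<^esub> h"
    if "g \<in> carrier N" "h \<in> carrier N"
    using pres_lift_gen[OF H f R, of "ext_square_rels N" "(g, h)"] that
    unfolding commutator_map_def wedge_def by simp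
qed

lemma schur_multiplier_comm_group:
  assumes "comm_group N"
  shows "schur_multiplier N = ext_square N"
proof -
  interpret N: comm_group N by fact
  have "carrier (derived_subgroup N) = {\<one>\<^bsub>N\<^esub>}"
    by (simp add: derived_subgroup_def N.derived_eq_singleton)
  hence "commutator_map N X = \<one>\<^bsub>N\<^esub>" if "X \<in> carrier (ext_square N)" for X
    using hom_in_carrier[OF commutator_map_hom(1)[OF N.is_group] that] by simp
  hence "kernel (ext_square N) (derived_subgroup N) (commutator_map N) = carrier (ext_square N)"
    by (auto simp: kernel_def derived_subgroup_def)
  thus ?thesis by (simp add: schur_multiplier_def)
qed

lemma commutator_cocycle_bilinear:
  fixes N (structure) and B (structure)
  assumes "comm_group N" "comm_group B" and eps: "\<epsilon> \<in> cocycles2 N B (\<lambda>a g. a)"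
    and c: "x \<in> carrier N" "y \<in> carrier N" "z \<in> carrier N"
  shows "\<epsilon> (x \<otimes>\<^bsub>N\<^esub> y) z \<otimes>\<^bsub>B\<^esub> inv\<^bsub>B\<^esub> \<epsilon> z (x \<otimes>\<^bsub>N\<^esub> y) =
    (\<epsilon> y z \<otimes>\<^bsub>B\<^esub> inv\<^bsub>B\<^esub> \<epsilon> z y) \<otimes>\<^bsub>B\<^esub> (\<epsilon> x z \<otimes>\<^bsub>B\<^esub> inv\<^bsub>B\<^esub> \<epsilon> z x)"
proof -
  interpret N: comm_group N by fact
  interpret B: comm_group B by fact
  have cl [simp]: "\<epsilon> g h \<in> carrier B" if "g \<in> carrier N" "h \<in> carrier N" for g h
    using eps that by (auto simp: cocycles2_def)
  have co: "\<epsilon> g h \<otimes>\<^bsub>B\<^esub> \<epsilon> (g \<otimes>\<^bsub>N\<^esub> h) k = \<epsilon> h k \<otimes>\<^bsub>B\<^esub> \<epsilon> g (h \<otimes>\<^bsub>N\<^esub> k)"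
    if "g \<in> carrier N" "h \<in> carrier N" "k \<in> carrier N" for g h k
    using eps that by (auto simp: cocycles2_def)
  define p q r where "p = \<epsilon> x y" and "q = \<epsilon> x (y \<otimes>\<^bsub>N\<^esub> z)" and "r = \<epsilon> (x \<otimes>\<^bsub>N\<^esub> z) y"
  have pqr: "p \<in> carrier B" "q \<in> carrier B" "r \<in> carrier B"
    using c by (simp_all add: p_def q_def r_def)
  have e1: "p \<otimes>\<^bsub>B\<^esub> \<epsilon> (x \<otimes>\<^bsub>N\<^esub> y) z = \<epsilon> y z \<otimes>\<^bsub>B\<^esub> q"
    using co[OF c] by (simp add: p_def q_def)
  have e2: "\<epsilon> z x \<otimes>\<^bsub>B\<^esub> r = p \<otimes>\<^bsub>B\<^esub> \<epsilon> z (x \<otimes>\<^bsub>N\<^esub> y)"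
    using co[of z x y] c by (simp add: p_def r_def N.m_comm[of z x])
  have e3: "\<epsilon> x z \<otimes>\<^bsub>B\<^esub> r = \<epsilon> z y \<otimes>\<^bsub>B\<^esub> q"
    using co[of x z y] c by (simp add: q_def r_def N.m_comm[of z y])
  have alg: "a \<otimes>\<^bsub>B\<^esub> inv\<^bsub>B\<^esub> b = (d \<otimes>\<^bsub>B\<^esub> inv\<^bsub>B\<^esub> e) \<otimes>\<^bsub>B\<^esub> (f \<otimes>\<^bsub>B\<^esub> inv\<^bsub>B\<^esub> g)"
    if h: "p \<otimes>\<^bsub>B\<^esub> a = d \<otimes>\<^bsub>B\<^esub> q" "g \<otimes>\<^bsub>B\<^esub> r = p \<otimes>\<^bsub>B\<^esub> b" "f \<otimes>\<^bsub>B\<^esub> r = e \<otimes>\<^bsub>B\<^esub> q"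
      and k: "a \<in> carrier B" "b \<in> carrier B" "d \<in> carrier B" "e \<in> carrier B" "f \<in> carrier B" "g \<in> carrier B"
    for a b d e f g
  proof -
    have a: "a = inv\<^bsub>B\<^esub> p \<otimes>\<^bsub>B\<^esub> (d \<otimes>\<^bsub>B\<^esub> q)" using h(1) k pqr
      by (metis B.inv_solve_left' B.m_closed)
    have b: "b = inv\<^bsub>B\<^esub> p \<otimes>\<^bsub>B\<^esub> (g \<otimes>\<^bsub>B\<^esub> r)" using h(2) k pqr
      by (metis B.inv_solve_left' B.m_closed)
    have f: "f = (e \<otimes>\<^bsub>B\<^esub> q) \<otimes>\<^bsub>B\<^esub> inv\<^bsub>B\<^esub> r" using h(3) k pqr
      by (metis B.inv_solve_right' B.m_closed)
    have cc: "u \<otimes>\<^bsub>B\<^esub> (inv\<^bsub>B\<^esub> u \<otimes>\<^bsub>B\<^esub> v) = v" "inv\<^bsub>B\<^esub> u \<otimes>\<^bsub>B\<^esub> (u \<otimes>\<^bsub>B\<^esub> v) = v"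
      if "u \<in> carrier B" "v \<in> carrier B" for u v
      using that by (simp_all add: B.m_assoc[symmetric])
    have lc: "u \<otimes>\<^bsub>B\<^esub> (v \<otimes>\<^bsub>B\<^esub> (inv\<^bsub>B\<^esub> u \<otimes>\<^bsub>B\<^esub> w)) = v \<otimes>\<^bsub>B\<^esub> w"
      if "u \<in> carrier B" "v \<in> carrier B" "w \<in> carrier B" for u v w
      using that by (simp add: B.m_lcomm[of u v] cc)
    have "a \<otimes>\<^bsub>B\<^esub> inv\<^bsub>B\<^esub> b = d \<otimes>\<^bsub>B\<^esub> q \<otimes>\<^bsub>B\<^esub> inv\<^bsub>B\<^esub> g \<otimes>\<^bsub>B\<^esub> inv\<^bsub>B\<^esub> r"
    proof -
      have "a \<otimes>\<^bsub>B\<^esub> inv\<^bsub>B\<^esub> b = p \<otimes>\<^bsub>B\<^esub> a \<otimes>\<^bsub>B\<^esub> inv\<^bsub>B\<^esub> (p \<otimes>\<^bsub>B\<^esub> b)"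
        using k pqr by (simp add: B.inv_mult B.m_assoc lc)
      thus ?thesis using k pqr h(1) h(2)[symmetric] by (simp add: B.inv_mult B.m_assoc)
    qed
    also have "\<dots> = (d \<otimes>\<^bsub>B\<^esub> inv\<^bsub>B\<^esub> e) \<otimes>\<^bsub>B\<^esub> (f \<otimes>\<^bsub>B\<^esub> inv\<^bsub>B\<^esub> g)"
      unfolding f using k pqr by (simp add: B.m_assoc cc B.m_comm[of "inv\<^bsub>B\<^esub> r"])
    finally show ?thesis .
  qed
  show ?thesis using c by (intro alg e1 e2 e3) simp_all
qed

lemma kappa_hom:
  assumes "comm_group N" "comm_group B" and eps: "\<epsilon> \<in> cocycles2 N B (\<lambda>a g. a)"
  shows "kappa N B \<epsilon> \<in> hom (schur_multiplier N) B"
    and "\<lbrakk>g \<in> carrier N; h \<in> carrier N\<rbrakk> \<Longrightarrow> kappa N B \<epsilon> (wedge N g h) = \<epsilon> g h \<otimes>\<^bsub>B\<^esub> inv\<^bsub>B\<^esub> \<epsilon> h g"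
proof -
  interpret N: comm_group N by fact
  interpret B: comm_group B by fact
  let ?c = "\<lambda>(g, h). \<epsilon> g h \<otimes>\<^bsub>B\<^esub> inv\<^bsub>B\<^esub> \<epsilon> h g"
  have cl [simp]: "\<epsilon> g h \<in> carrier B" if "g \<in> carrier N" "h \<in> carrier N" for g h
    using eps that by (auto simp: cocycles2_def)
  note bil = commutator_cocycle_bilinear[OF assms]
  have f: "?c \<in> carrier N \<times> carrier N \<rightarrow> carrier B" by auto
  have conj: "x \<otimes>\<^bsub>N\<^esub> y \<otimes>\<^bsub>N\<^esub> inv\<^bsub>N\<^esub> x = y" if "x \<in> carrier N" "y \<in> carrier N" for x y
    using that by (simp add: N.m_comm[of x y] N.m_assoc)
  have bil': "\<epsilon> z (x \<otimes>\<^bsub>N\<^esub> y) \<otimes>\<^bsub>B\<^esub> inv\<^bsub>B\<^esub> \<epsilon> (x \<otimes>\<^bsub>N\<^esub> y) z =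
      (\<epsilon> z x \<otimes>\<^bsub>B\<^esub> inv\<^bsub>B\<^esub> \<epsilon> x z) \<otimes>\<^bsub>B\<^esub> (\<epsilon> z y \<otimes>\<^bsub>B\<^esub> inv\<^bsub>B\<^esub> \<epsilon> y z)"
    if c: "x \<in> carrier N" "y \<in> carrier N" "z \<in> carrier N" for x y z
  proof -
    have inv: "inv\<^bsub>B\<^esub> (\<epsilon> g h \<otimes>\<^bsub>B\<^esub> inv\<^bsub>B\<^esub> \<epsilon> h g) = \<epsilon> h g \<otimes>\<^bsub>B\<^esub> inv\<^bsub>B\<^esub> \<epsilon> g h"
      if "g \<in> carrier N" "h \<in> carrier N" for g h
      using that by (simp add: B.inv_mult_group)
    have "\<epsilon> z (x \<otimes>\<^bsub>N\<^esub> y) \<otimes>\<^bsub>B\<^esub> inv\<^bsub>B\<^esub> \<epsilon> (x \<otimes>\<^bsub>N\<^esub> y) z =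
        inv\<^bsub>B\<^esub> (\<epsilon> (x \<otimes>\<^bsub>N\<^esub> y) z \<otimes>\<^bsub>B\<^esub> inv\<^bsub>B\<^esub> \<epsilon> z (x \<otimes>\<^bsub>N\<^esub> y))"
      using c by (simp only: inv N.m_closed)
    also have "\<dots> = inv\<^bsub>B\<^esub> ((\<epsilon> y z \<otimes>\<^bsub>B\<^esub> inv\<^bsub>B\<^esub> \<epsilon> z y) \<otimes>\<^bsub>B\<^esub> (\<epsilon> x z \<otimes>\<^bsub>B\<^esub> inv\<^bsub>B\<^esub> \<epsilon> z x))"
      using bil[OF c] by simp
    also have "\<dots> = inv\<^bsub>B\<^esub> (\<epsilon> x z \<otimes>\<^bsub>B\<^esub> inv\<^bsub>B\<^esub> \<epsilon> z x) \<otimes>\<^bsub>B\<^esub> inv\<^bsub>B\<^esub> (\<epsilon> y z \<otimes>\<^bsub>B\<^esub> inv\<^bsub>B\<^esub> \<epsilon> z y)"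
      using c by (intro B.inv_mult_group) auto
    finally show ?thesis using c by (simp only: inv)
  qed
  have R: "word_eval B ?c u = word_eval B ?c v" if "(u, v) \<in> ext_square_rels N" for u v
    using that unfolding ext_square_rels_def
  proof (elim UnE CollectE exE conjE, goal_cases)
    case (1 g g' h) thus ?case using bil[of g g' h] by (simp add: conj)
  next
    case (2 g h h') thus ?case using bil'[of h h' g] by (simp add: conj)
  next
    case (3 h) thus ?case by simp
  qed
  note M = schur_multiplier_comm_group[OF assms(1)]
  have L: "pres_lift B ?c \<in> hom (ext_square N) B"
    unfolding ext_square_def by (rule pres_lift_hom[OF B.is_group f R])
  interpret E: group "ext_square N"
    unfolding ext_square_def by (rule group_presented_group)
  show "kappa N B \<epsilon> \<in> hom (schur_multiplier N) B"
    unfolding M using L by (auto simp: kappa_def M hom_def Pi_def)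
  show "kappa N B \<epsilon> (wedge N g h) = \<epsilon> g h \<otimes>\<^bsub>B\<^esub> inv\<^bsub>B\<^esub> \<epsilon> h g" if "g \<in> carrier N" "h \<in> carrier N"
    using pres_lift_gen[OF B.is_group f R, of "ext_square_rels N" "(g, h)"] that
      pres_gen_closed[of "(g, h)" "carrier N \<times> carrier N" "ext_square_rels N"]
    unfolding kappa_def M by (simp add: wedge_def ext_square_def)
qed

lemma kappa_unique:
  assumes "comm_group N" "comm_group B" "\<epsilon> \<in> cocycles2 N B (\<lambda>a g. a)"
    and "k \<in> hom (schur_multiplier N) B"
    and "\<And>g h. \<lbrakk>g \<in> carrier N; h \<in> carrier N\<rbrakk> \<Longrightarrow> k (wedge N g h) = \<epsilon> g h \<otimes>\<^bsub>B\<^esub> inv\<^bsub>B\<^esub> \<epsilon> h g"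
    and "X \<in> carrier (schur_multiplier N)"
  shows "k X = kappa N B \<epsilon> X"
proof (rule pres_hom_eqI)
  note M = schur_multiplier_comm_group[OF assms(1), unfolded ext_square_def]
  show "group B" using assms(2) by (rule comm_group.axioms)
  show "k \<in> hom (presented_group (carrier N \<times> carrier N) (ext_square_rels N)) B"
    using assms(4) unfolding M .
  show "kappa N B \<epsilon> \<in> hom (presented_group (carrier N \<times> carrier N) (ext_square_rels N)) B"
    using kappa_hom(1)[OF assms(1-3)] unfolding M .
  show "X \<in> carrier (presented_group (carrier N \<times> carrier N) (ext_square_rels N))"
    using assms(6) unfolding M .
  fix x assume "x \<in> carrier N \<times> carrier N"
  then obtain g h where x: "x = (g, h)" "g \<in> carrier N" "h \<in> carrier N" by blast
  show "k (pres_gen (carrier N \<times> carrier N) (ext_square_rels N) x) =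
      kappa N B \<epsilon> (pres_gen (carrier N \<times> carrier N) (ext_square_rels N) x)"
    using assms(5)[OF x(2,3)] kappa_hom(2)[OF assms(1-3) x(2,3)] unfolding x(1) wedge_def by simp
qed

lemma sigma_cocycle:
  assumes "right_module G A act" "solvable G" "carrier G \<noteq> {\<one>\<^bsub>G\<^esub>}"
    and delta: "\<delta> \<in> cocycles2 G A act" and U: "U = module_commutator A act (gamma G)"
  shows "U \<lhd> A" and "comm_group (A Mod U)"
    and "sigma A U \<delta> \<in> cocycles2 (gamma_group G) (A Mod U) (\<lambda>a g. a)"
proof -
  interpret right_module G A act by fact
  have sub: "subgroup (gamma G) G"
    by (rule comm_group_gamma_group(1)[OF group_axioms assms(2,3)])
  have gG: "g \<in> carrier G" if "g \<in> gamma G" for g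
    using that subgroup.subset[OF sub] by blast
  have "subgroup U A" unfolding U module_commutator_def
    by (rule A.generate_is_subgroup) (auto simp: act_closed gG)
  thus nU: "U \<lhd> A" by (rule A.subgroup_imp_normal)
  interpret U: normal U A by (rule nU)
  show "comm_group (A Mod U)" by (rule A.abelian_FactGroup[OF \<open>subgroup U A\<close>])
  have triv: "U #>\<^bsub>A\<^esub> act a g = U #>\<^bsub>A\<^esub> a" if "a \<in> carrier A" "g \<in> gamma G" for a g
  proof -
    have "act a g \<otimes>\<^bsub>A\<^esub> inv\<^bsub>A\<^esub> a \<in> U"
      unfolding U module_commutator_def by (rule generate.incl) (use that in blast)
    moreover have "act a g \<in> carrier A" using that gG by (simp add: act_closed)
    moreover from this have "act a g = (act a g \<otimes>\<^bsub>A\<^esub> inv\<^bsub>A\<^esub> a) \<otimes>\<^bsub>A\<^esub> a"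
      using that by (simp add: A.m_assoc)
    ultimately have "act a g \<in> U #>\<^bsub>A\<^esub> a"
      using A.rcosI[OF _ U.subset that(1)] by metis
    thus ?thesis using A.repr_independence[OF _ that(1) \<open>subgroup U A\<close>] by simp
  qed
  have dc: "\<delta> g h \<in> carrier A" if "g \<in> carrier G" "h \<in> carrier G" for g h
    using delta that by (simp add: cocycles2_def)
  have co: "act (\<delta> g h) k \<otimes>\<^bsub>A\<^esub> \<delta> (g \<otimes>\<^bsub>G\<^esub> h) k = \<delta> h k \<otimes>\<^bsub>A\<^esub> \<delta> g (h \<otimes>\<^bsub>G\<^esub> k)"
    if "g \<in> carrier G" "h \<in> carrier G" "k \<in> carrier G" for g h k
    using delta that by (simp add: cocycles2_def)
  have n: "\<delta> g \<one>\<^bsub>G\<^esub> = \<one>\<^bsub>A\<^esub>" "\<delta> \<one>\<^bsub>G\<^esub> g = \<one>\<^bsub>A\<^esub>" if "g \<in> carrier G" for g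
    using delta that by (simp_all add: cocycles2_def)
  have m: "g \<otimes>\<^bsub>G\<^esub> h \<in> gamma G" if "g \<in> gamma G" "h \<in> gamma G" for g h
    using that by (rule subgroup.m_closed[OF sub])
  have s: "(U #>\<^bsub>A\<^esub> a) \<otimes>\<^bsub>A Mod U\<^esub> (U #>\<^bsub>A\<^esub> b) = U #>\<^bsub>A\<^esub> (a \<otimes>\<^bsub>A\<^esub> b)"
    if "a \<in> carrier A" "b \<in> carrier A" for a b
    using U.rcos_sum[OF that] by (simp add: FactGroup_def)
  have "(U #>\<^bsub>A\<^esub> \<delta> g h) \<otimes>\<^bsub>A Mod U\<^esub> (U #>\<^bsub>A\<^esub> \<delta> (g \<otimes>\<^bsub>G\<^esub> h) k) =
      (U #>\<^bsub>A\<^esub> \<delta> h k) \<otimes>\<^bsub>A Mod U\<^esub> (U #>\<^bsub>A\<^esub> \<delta> g (h \<otimes>\<^bsub>G\<^esub> k))"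
    if "g \<in> gamma G" "h \<in> gamma G" "k \<in> gamma G" for g h k
  proof -
    have "(U #>\<^bsub>A\<^esub> \<delta> g h) \<otimes>\<^bsub>A Mod U\<^esub> (U #>\<^bsub>A\<^esub> \<delta> (g \<otimes>\<^bsub>G\<^esub> h) k) =
        (U #>\<^bsub>A\<^esub> act (\<delta> g h) k) \<otimes>\<^bsub>A Mod U\<^esub> (U #>\<^bsub>A\<^esub> \<delta> (g \<otimes>\<^bsub>G\<^esub> h) k)"
      using triv[of "\<delta> g h" k] that gG dc by simp
    also have "\<dots> = U #>\<^bsub>A\<^esub> (act (\<delta> g h) k \<otimes>\<^bsub>A\<^esub> \<delta> (g \<otimes>\<^bsub>G\<^esub> h) k)"
      using that gG dc m act_closed by (intro s) auto
    also have "\<dots> = U #>\<^bsub>A\<^esub> (\<delta> h k \<otimes>\<^bsub>A\<^esub> \<delta> g (h \<otimes>\<^bsub>G\<^esub> k))"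
      using co that gG by simp
    also have "\<dots> = (U #>\<^bsub>A\<^esub> \<delta> h k) \<otimes>\<^bsub>A Mod U\<^esub> (U #>\<^bsub>A\<^esub> \<delta> g (h \<otimes>\<^bsub>G\<^esub> k))"
      using that gG dc m by (intro s[symmetric]) auto
    finally show ?thesis .
  qed
  moreover have "U #>\<^bsub>A\<^esub> \<delta> g h \<in> carrier (A Mod U)" if "g \<in> gamma G" "h \<in> gamma G" for g h
    using dc[OF gG gG] that U.subset by (simp add: FactGroup_def A.rcosetsI)
  moreover have "U #>\<^bsub>A\<^esub> \<one>\<^bsub>A\<^esub> = \<one>\<^bsub>A Mod U\<^esub>"
    using U.subset by (simp add: FactGroup_def A.coset_mult_one)
  ultimately show "sigma A U \<delta> \<in> cocycles2 (gamma_group G) (A Mod U) (\<lambda>a g. a)"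
    by (simp add: cocycles2_def sigma_def gamma_group_def n gG)
qed

lemma group_extension:
  fixes G (structure)
  assumes "right_module G A act" and delta: "\<delta> \<in> cocycles2 G A act"
  shows "group (extension G A act \<delta>)"
proof -
  interpret right_module G A act by fact
  have dc [simp]: "\<delta> g h \<in> carrier A" if "g \<in> carrier G" "h \<in> carrier G" for g h
    using delta that by (simp add: cocycles2_def)
  have co: "act (\<delta> g h) k \<otimes>\<^bsub>A\<^esub> \<delta> (g \<otimes> h) k = \<delta> h k \<otimes>\<^bsub>A\<^esub> \<delta> g (h \<otimes> k)"
    if "g \<in> carrier G" "h \<in> carrier G" "k \<in> carrier G" for g h k
    using delta that by (simp add: cocycles2_def)
  have n [simp]: "\<delta> g \<one> = \<one>\<^bsub>A\<^esub>" "\<delta> \<one> g = \<one>\<^bsub>A\<^esub>" if "g \<in> carrier G" for g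
    using delta that by (simp_all add: cocycles2_def)
  note [simp] = act_closed
  have one [simp]: "act \<one>\<^bsub>A\<^esub> g = \<one>\<^bsub>A\<^esub>" if "g \<in> carrier G" for g
  proof -
    have "act \<one>\<^bsub>A\<^esub> g \<otimes>\<^bsub>A\<^esub> act \<one>\<^bsub>A\<^esub> g = act \<one>\<^bsub>A\<^esub> g"
      using act_mult[of "\<one>\<^bsub>A\<^esub>" "\<one>\<^bsub>A\<^esub>" g] that by simp
    thus ?thesis using that by simp
  qed
  have assoc: "act (act a h \<otimes>\<^bsub>A\<^esub> b \<otimes>\<^bsub>A\<^esub> \<delta> g h) k \<otimes>\<^bsub>A\<^esub> c \<otimes>\<^bsub>A\<^esub> \<delta> (g \<otimes> h) k =
      act a (h \<otimes> k) \<otimes>\<^bsub>A\<^esub> (act b k \<otimes>\<^bsub>A\<^esub> c \<otimes>\<^bsub>A\<^esub> \<delta> h k) \<otimes>\<^bsub>A\<^esub> \<delta> g (h \<otimes> k)"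
    if m: "g \<in> carrier G" "h \<in> carrier G" "k \<in> carrier G" "a \<in> carrier A" "b \<in> carrier A" "c \<in> carrier A"
    for g h k a b c
  proof -
    have "act (act a h \<otimes>\<^bsub>A\<^esub> b \<otimes>\<^bsub>A\<^esub> \<delta> g h) k \<otimes>\<^bsub>A\<^esub> c \<otimes>\<^bsub>A\<^esub> \<delta> (g \<otimes> h) k =
        act (act a h) k \<otimes>\<^bsub>A\<^esub> act b k \<otimes>\<^bsub>A\<^esub> c \<otimes>\<^bsub>A\<^esub> (act (\<delta> g h) k \<otimes>\<^bsub>A\<^esub> \<delta> (g \<otimes> h) k)"
      using m by (simp add: act_mult A.m_ac)
    also have "\<dots> = act a (h \<otimes> k) \<otimes>\<^bsub>A\<^esub> act b k \<otimes>\<^bsub>A\<^esub> c \<otimes>\<^bsub>A\<^esub> (\<delta> h k \<otimes>\<^bsub>A\<^esub> \<delta> g (h \<otimes> k))"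
      using m by (simp only: co act_act)
    also have "\<dots> = act a (h \<otimes> k) \<otimes>\<^bsub>A\<^esub> (act b k \<otimes>\<^bsub>A\<^esub> c \<otimes>\<^bsub>A\<^esub> \<delta> h k) \<otimes>\<^bsub>A\<^esub> \<delta> g (h \<otimes> k)"
      using m by (simp add: A.m_assoc)
    finally show ?thesis .
  qed
  have inverse: "\<exists>b\<in>carrier A. act b g \<otimes>\<^bsub>A\<^esub> a \<otimes>\<^bsub>A\<^esub> \<delta> (inv g) g = \<one>\<^bsub>A\<^esub>"
    if "g \<in> carrier G" "a \<in> carrier A" for g a
  proof (rule bexI[of _ "act (inv\<^bsub>A\<^esub> (a \<otimes>\<^bsub>A\<^esub> \<delta> (inv g) g)) (inv g)"])
    have "act (act (inv\<^bsub>A\<^esub> (a \<otimes>\<^bsub>A\<^esub> \<delta> (inv g) g)) (inv g)) g = inv\<^bsub>A\<^esub> (a \<otimes>\<^bsub>A\<^esub> \<delta> (inv g) g)"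
      using that by (simp add: act_act[symmetric] act_one)
    thus "act (act (inv\<^bsub>A\<^esub> (a \<otimes>\<^bsub>A\<^esub> \<delta> (inv g) g)) (inv g)) g \<otimes>\<^bsub>A\<^esub> a \<otimes>\<^bsub>A\<^esub> \<delta> (inv g) g = \<one>\<^bsub>A\<^esub>"
      using that by (simp add: A.m_assoc)
  qed (use that in simp)
  show ?thesis
  proof (rule groupI)
    fix p assume "p \<in> carrier (extension G A act \<delta>)"
    then obtain g a where p: "p = (g, a)" "g \<in> carrier G" "a \<in> carrier A"
      by (auto simp: extension_def)
    then obtain b where "b \<in> carrier A" "act b g \<otimes>\<^bsub>A\<^esub> a \<otimes>\<^bsub>A\<^esub> \<delta> (inv g) g = \<one>\<^bsub>A\<^esub>"
      using inverse by blast
    thus "\<exists>q\<in>carrier (extension G A act \<delta>). q \<otimes>\<^bsub>extension G A act \<delta>\<^esub> p = \<one>\<^bsub>extension G A act \<delta>\<^esub>"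
      using p by (intro bexI[of _ "(inv g, b)"]) (simp_all add: extension_def)
  qed (auto simp: extension_def assoc m_assoc)
qed

end

theory Submission
  imports Defs
begin

text \<open>
  Write \<open>N = \<gamma>(G) = G\<^sup>(\<^sup>n\<^sup>)\<close> and let \<open>F\<close> be the preimage of \<open>N\<close> in \<open>E\<close>, \<open>K\<close> the kernel of \<open>E \<rightarrow> G\<close>. Since
  \<open>E\<^sup>(\<^sup>n\<^sup>) \<subseteq> F\<close> and \<open>[F, F] \<subseteq> K\<close>, we have \<open>E\<^sup>(\<^sup>n\<^sup>+\<^sup>1\<^sup>) \<subseteq> [F, F] \<subseteq> K\<close>; conversely, if \<open>[F, F] = K\<close>, then
  \<open>K \<subseteq> E\<^sup>(\<^sup>j\<^sup>)\<close> forces \<open>F \<subseteq> E\<^sup>(\<^sup>j\<^sup>)\<close> and hence \<open>K \<subseteq> E\<^sup>(\<^sup>j\<^sup>+\<^sup>1\<^sup>)\<close> for \<open>j \<le> n\<close>. So \<open>E\<close> is a derived series extension iff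
  \<open>[F, F] = K\<close>. Commutators of \<open>F\<close> with \<open>K\<close> generate \<open>U\<close>, and modulo \<open>U\<close> the commutator of
  \<open>(g, a)\<close> and \<open>(h, b)\<close> is \<open>\<delta>(g, h) - \<delta>(h, g)\<close>, so \<open>[F, F]\<close> is the preimage in \<open>A\<close> of the image of
  \<open>\<kappa>(\<sigma>(\<delta>))\<close>.
\<close>

section \<open>Commutators and subgroups in arbitrary groups\<close>

lemma (in group_hom) subgroup_preimage:
  assumes "subgroup K H"
  shows "subgroup {x \<in> carrier G. h x \<in> K} G"
proof -
  interpret K: subgroup K H by fact
  show ?thesis by unfold_locales auto
qed

text \<open>An inverse-free way to pin down a commutator: in an extension, where inverses have an
  awkward formula, only products need to be computed.\<close>

lemma (in group) commutator_mult:
  assumes "x \<in> carrier G" "y \<in> carrier G"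
  shows "x \<otimes> y \<otimes> inv x \<otimes> inv y \<otimes> (y \<otimes> x) = x \<otimes> y"
proof -
  have "inv y \<otimes> (y \<otimes> x) = x"
    using assms by (simp add: m_assoc[symmetric])
  thus ?thesis using assms by (simp add: m_assoc)
qed

lemma (in group) commutator_in_derived:
  "\<lbrakk>x \<in> K; y \<in> K\<rbrakk> \<Longrightarrow> x \<otimes> y \<otimes> inv x \<otimes> inv y \<in> derived G K"
  unfolding derived_def by (rule generate.incl) blast

lemma (in group) derived_subsetI:
  assumes "subgroup H G"
    and "\<And>x y. \<lbrakk>x \<in> K; y \<in> K\<rbrakk> \<Longrightarrow> x \<otimes> y \<otimes> inv x \<otimes> inv y \<in> H"
  shows "derived G K \<subseteq> H"
  unfolding derived_def by (rule generate_subgroup_incl[OF _ assms(1)]) (use assms(2) in blast)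

text \<open>The shape of the equation in \<open>commutator_eq\<close> modulo \<open>U\<close>: the
  classes \<open>x\<close> and \<open>y\<close> of the module components cancel, and only the
  cocycle values \<open>v\<close> and \<open>w\<close> remain.\<close>

lemma (in comm_group) swapped_products_quotient:
  assumes "z \<otimes> (y \<otimes> x \<otimes> v) = x \<otimes> y \<otimes> w"
    and m: "x \<in> carrier G" "y \<in> carrier G" "z \<in> carrier G" "v \<in> carrier G" "w \<in> carrier G"
  shows "z = w \<otimes> inv v"
proof -
  have "(x \<otimes> y) \<otimes> (z \<otimes> v) = (x \<otimes> y) \<otimes> w"
    using assms by (simp add: m_ac)
  hence "z \<otimes> v = w" using m by simp
  thus ?thesis using m by (metis inv_solve_right)
qed

section \<open>Homomorphisms on presented groups and the image of \<open>kappa\<close>\<close>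

text \<open>Induction on words: each letter is a generator or, by \<open>cancel\<close>, the inverse
  of one, and \<open>K\<close> is closed under products and inverses.\<close>

lemma pres_hom_image_subset:
  assumes "group H" and p: "p \<in> hom (presented_group S R) H" and "subgroup K H"
    and gen: "\<And>x. x \<in> S \<Longrightarrow> p (pres_gen S R x) \<in> K"
  shows "p ` carrier (presented_group S R) \<subseteq> K"
proof -
  let ?P = "presented_group S R"
  interpret K: subgroup K H by fact
  interpret P: group ?P by (rule group_presented_group)
  interpret p: group_hom ?P H p
    using assms by (simp add: group_hom_def group_hom_axioms_def P.group_axioms)
  have letter: "p (pres_rel S R `` {[(x, b)]}) \<in> K" if x: "x \<in> S" for x b
  proof (cases b)
    case True thus ?thesis using gen[OF x] by (simp add: pres_gen_def)
  next
    case False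
    have c: "pres_rel S R `` {[(x, False)]} \<in> carrier ?P" using x by (simp add: pres_class_closed)
    have "pres_rel S R `` {[(x, False)]} \<otimes>\<^bsub>?P\<^esub> pres_gen S R x = \<one>\<^bsub>?P\<^esub>"
      using x equiv_class_eq[OF equiv_pres_rel pres_rel.cancel[OF x, of False R]]
      by (simp add: pres_gen_def pres_mult_class pres_one)
    hence "pres_rel S R `` {[(x, False)]} = inv\<^bsub>?P\<^esub> pres_gen S R x"
      using P.inv_equality[OF _ pres_gen_closed[OF x] c] by simp
    thus ?thesis using False gen[OF x] x by (simp add: pres_gen_closed)
  qed
  have word: "p (pres_rel S R `` {w}) \<in> K" if "w \<in> words S" for w
    using that
  proof (induction w rule: list.induct)
    case Nil
    show ?case using p.hom_one by (simp add: pres_one)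
  next
    case (Cons l w)
    obtain x b where l0: "l = (x, b)" by (cases l)
    hence l: "l = (x, b)" "x \<in> S" using Cons.prems by auto
    have w: "w \<in> words S" using Cons.prems by auto
    have "pres_rel S R `` {l # w} =
        (pres_rel S R `` {[(x, b)]}) \<otimes>\<^bsub>?P\<^esub> (pres_rel S R `` {w})"
      using l w by (simp add: pres_mult_class)
    thus ?case using l w Cons.IH letter by (simp add: pres_class_closed)
  qed
  show ?thesis
  proof (rule image_subsetI)
    fix X assume "X \<in> carrier ?P"
    then obtain w where "w \<in> words S" "X = pres_rel S R `` {w}" by (rule pres_carrierE)
    thus "p X \<in> K" using word by simp
  qed
qed

text \<open>For abelian \<open>N\<close> the Schur multiplier is the whole exterior square, which
  the symbols \<open>wedge N g h\<close> generate. Surjectivity of \<open>kappa\<close> thus becomes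
  a statement about a generated subgroup of \<open>B\<close>, free of presentations.\<close>

lemma kappa_image:
  assumes N: "comm_group N" and B: "comm_group B" and eps: "\<epsilon> \<in> cocycles2 N B (\<lambda>a g. a)"
  shows "kappa N B \<epsilon> ` carrier (schur_multiplier N) =
    generate B {\<epsilon> g h \<otimes>\<^bsub>B\<^esub> inv\<^bsub>B\<^esub> \<epsilon> h g | g h. g \<in> carrier N \<and> h \<in> carrier N}"
    (is "_ = generate B ?T")
proof
  interpret B: comm_group B by fact
  note M = schur_multiplier_comm_group[OF N]
  have mult: "schur_multiplier N = presented_group (carrier N \<times> carrier N) (ext_square_rels N)"
    unfolding M ext_square_def ..
  have hom: "kappa N B \<epsilon> \<in> hom (schur_multiplier N) B"
    by (rule kappa_hom(1)[OF assms])
  have T: "?T \<subseteq> carrier B"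
    using eps by (auto simp: cocycles2_def)
  show "kappa N B \<epsilon> ` carrier (schur_multiplier N) \<subseteq> generate B ?T"
    unfolding mult
  proof (rule pres_hom_image_subset)
    show "subgroup (generate B ?T) B" by (rule B.generate_is_subgroup[OF T])
    fix x assume "x \<in> carrier N \<times> carrier N"
    then obtain g h where x: "x = (g, h)" "g \<in> carrier N" "h \<in> carrier N" by blast
    hence "kappa N B \<epsilon> (pres_gen (carrier N \<times> carrier N) (ext_square_rels N) x) =
        \<epsilon> g h \<otimes>\<^bsub>B\<^esub> inv\<^bsub>B\<^esub> \<epsilon> h g"
      using kappa_hom(2)[OF assms x(2,3)] by (simp add: wedge_def)
    thus "kappa N B \<epsilon> (pres_gen (carrier N \<times> carrier N) (ext_square_rels N) x) \<in> generate B ?T"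
      using x by (auto intro: generate.incl)
  qed (use hom mult B.is_group in auto)
  interpret k: group_hom "schur_multiplier N" B "kappa N B \<epsilon>"
    using hom group_presented_group[of "carrier N \<times> carrier N" "ext_square_rels N"] B.is_group
    by (simp add: group_hom_def group_hom_axioms_def mult)
  show "generate B ?T \<subseteq> kappa N B \<epsilon> ` carrier (schur_multiplier N)"
  proof (rule B.generate_subgroup_incl[OF _ k.img_is_subgroup], rule subsetI)
    fix t assume "t \<in> ?T"
    then obtain g h where t: "t = \<epsilon> g h \<otimes>\<^bsub>B\<^esub> inv\<^bsub>B\<^esub> \<epsilon> h g" "g \<in> carrier N" "h \<in> carrier N" by blast
    moreover have "wedge N g h \<in> carrier (schur_multiplier N)"
      unfolding mult wedge_def using t by (intro pres_gen_closed) simp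
    ultimately show "t \<in> kappa N B \<epsilon> ` carrier (schur_multiplier N)"
      using kappa_hom(2)[OF assms t(2,3)] by (metis imageI)
  qed
qed

section \<open>The extension with its projection and embedding\<close>

locale module_extension = right_module +
  fixes \<delta> :: "'a \<Rightarrow> 'a \<Rightarrow> 'b"
  assumes cocycle: "\<delta> \<in> cocycles2 G A act"
begin

abbreviation E where "E \<equiv> extension G A act \<delta>"

sublocale E: group E
  by (rule group_extension[OF right_module_axioms cocycle])

lemma cocycle_closed [simp]: "\<lbrakk>g \<in> carrier G; h \<in> carrier G\<rbrakk> \<Longrightarrow> \<delta> g h \<in> carrier A"
  and cocycle_one [simp]: "g \<in> carrier G \<Longrightarrow> \<delta> g \<one> = \<one>\<^bsub>A\<^esub>" "g \<in> carrier G \<Longrightarrow> \<delta> \<one> g = \<one>\<^bsub>A\<^esub>"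
  using cocycle by (simp_all add: cocycles2_def)

lemma act_one_left [simp]:
  assumes "g \<in> carrier G"
  shows "act \<one>\<^bsub>A\<^esub> g = \<one>\<^bsub>A\<^esub>"
proof -
  have "act \<one>\<^bsub>A\<^esub> g \<otimes>\<^bsub>A\<^esub> act \<one>\<^bsub>A\<^esub> g = act \<one>\<^bsub>A\<^esub> g"
    using act_mult[of "\<one>\<^bsub>A\<^esub>" "\<one>\<^bsub>A\<^esub>" g] assms by simp
  thus ?thesis using assms by (simp add: act_closed)
qed

lemma extension_mult:
  "(g, a) \<otimes>\<^bsub>E\<^esub> (h, b) = (g \<otimes> h, act a h \<otimes>\<^bsub>A\<^esub> b \<otimes>\<^bsub>A\<^esub> \<delta> g h)"
  by (simp add: extension_def)

lemma extension_one: "\<one>\<^bsub>E\<^esub> = (\<one>, \<one>\<^bsub>A\<^esub>)"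
  by (simp add: extension_def)

lemma proj_group_hom: "group_hom E G fst"
proof unfold_locales
  show "fst \<in> hom E G" unfolding hom_def extension_def by auto
qed

lemma emb_group_hom: "group_hom A E (Pair \<one>)"
proof unfold_locales
  show "Pair \<one> \<in> hom A E" unfolding hom_def extension_def by (auto simp: act_one)
qed

lemma carrier_extension: "carrier E = carrier G \<times> carrier A"
  by (simp add: extension_def)

lemma extension_kernel_eq: "extension_kernel G A = Pair \<one> ` carrier A"
  by (auto simp: extension_kernel_def)

lemma proj_image: "fst ` carrier E = carrier G"
  by (auto simp: carrier_extension)

text \<open>Equality rather than inclusion comes from surjectivity of the projection; it supplies
  lifts of elements of \<open>gamma G\<close> to terms of the series of \<open>E\<close>.\<close>

lemma proj_derived:
  "fst ` (derived E ^^ n) (carrier E) = (derived G ^^ n) (carrier G)"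
  using group_hom.exp_of_derived_img[OF proj_group_hom, of "carrier E" n] by (simp add: proj_image)

section \<open>Commutators in the extension\<close>

text \<open>Commuting images put the commutator into the kernel. Comparing second components in xy =
  [x,y]yx gives an implicit equation for \<open>c\<close>, from which
  \<open>\<delta> \<one> (h \<otimes> g)\<close> drops out by normalization.\<close>

lemma commutator_eq:
  assumes m: "g \<in> carrier G" "h \<in> carrier G" "a \<in> carrier A" "b \<in> carrier A"
    and gh: "g \<otimes> h = h \<otimes> g"
  obtains c where "c \<in> carrier A"
    and "(g, a) \<otimes>\<^bsub>E\<^esub> (h, b) \<otimes>\<^bsub>E\<^esub> inv\<^bsub>E\<^esub> (g, a) \<otimes>\<^bsub>E\<^esub> inv\<^bsub>E\<^esub> (h, b) = (\<one>, c)"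
    and "act c (h \<otimes> g) \<otimes>\<^bsub>A\<^esub> (act b g \<otimes>\<^bsub>A\<^esub> a \<otimes>\<^bsub>A\<^esub> \<delta> h g) = act a h \<otimes>\<^bsub>A\<^esub> b \<otimes>\<^bsub>A\<^esub> \<delta> g h"
proof -
  interpret proj: group_hom E G fst by (rule proj_group_hom)
  let ?x = "(g, a)" and ?y = "(h, b)"
  define z where "z = ?x \<otimes>\<^bsub>E\<^esub> ?y \<otimes>\<^bsub>E\<^esub> inv\<^bsub>E\<^esub> ?x \<otimes>\<^bsub>E\<^esub> inv\<^bsub>E\<^esub> ?y"
  have xy: "?x \<in> carrier E" "?y \<in> carrier E" using m by (simp_all add: carrier_extension)
  hence z: "z \<in> carrier E" unfolding z_def by simp
  have "z \<otimes>\<^bsub>E\<^esub> (?y \<otimes>\<^bsub>E\<^esub> ?x) = ?x \<otimes>\<^bsub>E\<^esub> ?y"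
    unfolding z_def by (rule E.commutator_mult[OF xy])
  moreover have "fst z = \<one>"
  proof -
    have "fst z = g \<otimes> h \<otimes> inv g \<otimes> inv h" unfolding z_def using xy by simp
    also have "\<dots> = \<one>" using m by (simp add: gh m_assoc)
    finally show ?thesis .
  qed
  then obtain c where c: "z = (\<one>, c)" "c \<in> carrier A"
    using z by (cases z) (auto simp: carrier_extension)
  ultimately have "act c (h \<otimes> g) \<otimes>\<^bsub>A\<^esub> (act b g \<otimes>\<^bsub>A\<^esub> a \<otimes>\<^bsub>A\<^esub> \<delta> h g) = act a h \<otimes>\<^bsub>A\<^esub> b \<otimes>\<^bsub>A\<^esub> \<delta> g h"
    using m by (simp add: extension_mult act_closed gh)
  thus ?thesis using that c unfolding z_def by blast
qed

text \<open>Each generator a^g - a of the module commutator is the commutator of (1, -a) and (g^-1,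
  0).\<close>

lemma module_commutator_subset_derived:
  assumes sub: "subgroup N G" and a: "a \<in> module_commutator A act N"
  shows "(\<one>, a) \<in> derived E (N \<times> carrier A)"
proof -
  interpret N: subgroup N G by fact
  interpret emb: group_hom A E "Pair \<one>" by (rule emb_group_hom)
  have "N \<times> carrier A \<subseteq> carrier E" using N.subset by (auto simp: carrier_extension)
  hence D: "subgroup {a \<in> carrier A. (\<one>, a) \<in> derived E (N \<times> carrier A)} A" (is "subgroup ?D A")
    by (intro emb.subgroup_preimage E.derived_is_subgroup)
  have "act a g \<otimes>\<^bsub>A\<^esub> inv\<^bsub>A\<^esub> a \<in> ?D" if a: "a \<in> carrier A" and gN: "g \<in> N" for a g
  proof -
    have g: "g \<in> carrier G" using gN by simp
    define b where "b = inv\<^bsub>A\<^esub> a"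
    have b: "b \<in> carrier A" using a by (simp add: b_def)
    \<comment> \<open>For these entries all cocycle values vanish, and the equation for
      \<open>c\<close> becomes c^(g^-1) + b = b^(g^-1).\<close>
    let ?x = "(\<one>, b)" and ?y = "(inv g, \<one>\<^bsub>A\<^esub>)"
    obtain c where c: "c \<in> carrier A" "?x \<otimes>\<^bsub>E\<^esub> ?y \<otimes>\<^bsub>E\<^esub> inv\<^bsub>E\<^esub> ?x \<otimes>\<^bsub>E\<^esub> inv\<^bsub>E\<^esub> ?y = (\<one>, c)"
      and "act c (inv g \<otimes> \<one>) \<otimes>\<^bsub>A\<^esub> (act \<one>\<^bsub>A\<^esub> \<one> \<otimes>\<^bsub>A\<^esub> b \<otimes>\<^bsub>A\<^esub> \<delta> (inv g) \<one>) =
        act b (inv g) \<otimes>\<^bsub>A\<^esub> \<one>\<^bsub>A\<^esub> \<otimes>\<^bsub>A\<^esub> \<delta> \<one> (inv g)"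
      by (rule commutator_eq[OF one_closed inv_closed[OF g] b A.one_closed]) (use g in simp)
    hence "act c (inv g) \<otimes>\<^bsub>A\<^esub> b = act b (inv g)"
      using b g by (simp add: act_closed)
    \<comment> \<open>Acting with \<open>g\<close> removes the twist by \<open>inv g\<close>; then c
      = b - b^g, which is a^g - a because b = -a.\<close>
    hence "act (act c (inv g) \<otimes>\<^bsub>A\<^esub> b) g = act (act b (inv g)) g" by simp
    hence "c \<otimes>\<^bsub>A\<^esub> act b g = b"
      using b g c by (simp add: act_closed act_mult act_act[symmetric] act_one)
    hence "act a g \<otimes>\<^bsub>A\<^esub> b = act a g \<otimes>\<^bsub>A\<^esub> (c \<otimes>\<^bsub>A\<^esub> act b g)" by simp
    also have "\<dots> = c \<otimes>\<^bsub>A\<^esub> act (b \<otimes>\<^bsub>A\<^esub> a) g"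
      using a b c g by (simp add: act_closed act_mult A.m_ac)
    also have "\<dots> = c"
      using a c g by (simp add: b_def)
    finally have "act a g \<otimes>\<^bsub>A\<^esub> b = c" .
    moreover have "(\<one>, c) \<in> derived E (N \<times> carrier A)"
      using E.commutator_in_derived[of ?x "N \<times> carrier A" ?y] b gN by (simp only: c(2)) simp
    ultimately show ?thesis using c by (simp add: b_def)
  qed
  hence "module_commutator A act N \<subseteq> ?D"
    unfolding module_commutator_def by (intro A.generate_subgroup_incl D) blast
  thus ?thesis using a by blast
qed

text \<open>In a^g = (a^g - a) + a the bracket is a generator of \<open>U\<close>. So modulo
  \<open>U\<close> the action disappears from products of elements over \<open>N\<close>.\<close>

lemma coset_act:
  assumes sub: "subgroup N G" and U: "U = module_commutator A act N"
    and a: "a \<in> carrier A" and g: "g \<in> N"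
  shows "U #>\<^bsub>A\<^esub> act a g = U #>\<^bsub>A\<^esub> a"
proof -
  have gG: "h \<in> carrier G" if "h \<in> N" for h using that subgroup.subset[OF sub] by blast
  have sU: "subgroup U A" unfolding U module_commutator_def
    by (rule A.generate_is_subgroup) (auto simp: act_closed gG)
  have "act a g \<otimes>\<^bsub>A\<^esub> inv\<^bsub>A\<^esub> a \<in> U"
    unfolding U module_commutator_def by (rule generate.incl) (use a g in blast)
  moreover have c: "act a g \<in> carrier A" using a gG g by (simp add: act_closed)
  moreover have "act a g = (act a g \<otimes>\<^bsub>A\<^esub> inv\<^bsub>A\<^esub> a) \<otimes>\<^bsub>A\<^esub> a"
    using a c by (simp add: A.m_assoc)
  ultimately have "act a g \<in> U #>\<^bsub>A\<^esub> a"
    using A.rcosI[OF _ subgroup.subset[OF sU] a] by metis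
  thus ?thesis using A.repr_independence[OF _ a sU] by simp
qed

text \<open>Modulo \<open>U\<close>, a commutator of elements over \<open>N\<close> depends only on
  the cocycle, so the right side, a subgroup, contains all commutators. Conversely, the left side
  contains \<open>U\<close> and an element above each generator, hence the full preimage.\<close>

lemma derived_preimage_eq:
  assumes sub: "subgroup N G" and comm_N: "comm_group (G\<lparr>carrier := N\<rparr>)"
    and U: "U = module_commutator A act N"
  shows "derived E (N \<times> carrier A) = Pair \<one> ` {a \<in> carrier A. U #>\<^bsub>A\<^esub> a \<in>
    generate (A Mod U) {sigma A U \<delta> g h \<otimes>\<^bsub>A Mod U\<^esub> inv\<^bsub>A Mod U\<^esub> sigma A U \<delta> h g | g h. g \<in> N \<and> h \<in> N}}"
    (is "?D = Pair \<one> ` {a \<in> carrier A. ?q a \<in> generate ?B ?T}")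
proof -
  interpret N: subgroup N G by fact
  interpret emb: group_hom A E "Pair \<one>" by (rule emb_group_hom)
  have sU: "subgroup U A" unfolding U module_commutator_def
    by (rule A.generate_is_subgroup) (auto simp: act_closed)
  interpret U: normal U A by (rule A.subgroup_imp_normal[OF sU])
  interpret B: comm_group ?B by (rule A.abelian_FactGroup[OF sU])
  interpret q: group_hom A ?B ?q
    by unfold_locales (rule U.r_coset_hom_Mod)
  have ab: "g \<otimes> h = h \<otimes> g" if "g \<in> N" "h \<in> N" for g h
    using comm_monoid.m_comm[OF comm_group.axioms(1)[OF comm_N], of g h] that by simp
  note act_q = coset_act[OF sub U]
  have NE: "N \<times> carrier A \<subseteq> carrier E" using N.subset by (auto simp: carrier_extension)
  \<comment> \<open>\<open>mult_FactGroup\<close> would unfold products in \<open>A Mod U\<close>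
    into set products, out of reach of the group laws of the quotient.\<close>
  have T: "?T \<subseteq> carrier ?B" by (auto simp: sigma_def simp del: mult_FactGroup)
  have comm: "\<exists>c\<in>carrier A. ?q c = ?q (\<delta> g h) \<otimes>\<^bsub>?B\<^esub> inv\<^bsub>?B\<^esub> ?q (\<delta> h g) \<and>
      (g, a) \<otimes>\<^bsub>E\<^esub> (h, b) \<otimes>\<^bsub>E\<^esub> inv\<^bsub>E\<^esub> (g, a) \<otimes>\<^bsub>E\<^esub> inv\<^bsub>E\<^esub> (h, b) = (\<one>, c)"
    if m: "g \<in> N" "h \<in> N" "a \<in> carrier A" "b \<in> carrier A" for g h a b
  proof -
    obtain c where c: "c \<in> carrier A"
        "(g, a) \<otimes>\<^bsub>E\<^esub> (h, b) \<otimes>\<^bsub>E\<^esub> inv\<^bsub>E\<^esub> (g, a) \<otimes>\<^bsub>E\<^esub> inv\<^bsub>E\<^esub> (h, b) = (\<one>, c)"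
      and e: "act c (h \<otimes> g) \<otimes>\<^bsub>A\<^esub> (act b g \<otimes>\<^bsub>A\<^esub> a \<otimes>\<^bsub>A\<^esub> \<delta> h g) = act a h \<otimes>\<^bsub>A\<^esub> b \<otimes>\<^bsub>A\<^esub> \<delta> g h"
      by (rule commutator_eq[OF N.mem_carrier[OF m(1)] N.mem_carrier[OF m(2)] m(3,4) ab[OF m(1,2)]])
    have "?q c \<otimes>\<^bsub>?B\<^esub> (?q b \<otimes>\<^bsub>?B\<^esub> ?q a \<otimes>\<^bsub>?B\<^esub> ?q (\<delta> h g)) = ?q a \<otimes>\<^bsub>?B\<^esub> ?q b \<otimes>\<^bsub>?B\<^esub> ?q (\<delta> g h)"
      using arg_cong[OF e, of ?q] m c by (simp add: act_closed act_q del: mult_FactGroup)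
    hence "?q c = ?q (\<delta> g h) \<otimes>\<^bsub>?B\<^esub> inv\<^bsub>?B\<^esub> ?q (\<delta> h g)"
      by (rule B.swapped_products_quotient) (use m c in simp_all)
    thus ?thesis using c by blast
  qed
  have sD: "subgroup ?D E" by (rule E.derived_is_subgroup[OF NE])
  \<comment> \<open>This is the derived subgroup seen inside \<open>A\<close>; as it contains
    \<open>U\<close>, a coset of \<open>U\<close> that meets \<open>V\<close> lies in
    \<open>V\<close>.\<close>
  define V where "V = {a \<in> carrier A. (\<one>, a) \<in> ?D}"
  have sV: "subgroup V A" unfolding V_def by (rule emb.subgroup_preimage[OF sD])
  have UV: "U \<subseteq> V"
    using module_commutator_subset_derived[OF sub] U.subset by (auto simp: V_def U)
  have "?T \<subseteq> ?q ` V"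
  proof
    fix t assume "t \<in> ?T"
    then obtain g h where t: "g \<in> N" "h \<in> N" "t = ?q (\<delta> g h) \<otimes>\<^bsub>?B\<^esub> inv\<^bsub>?B\<^esub> ?q (\<delta> h g)"
      unfolding sigma_def by blast
    \<comment> \<open>The class of the commutator does not depend on the module components, so both
      can be taken to be zero.\<close>
    then obtain c where c: "c \<in> carrier A" "?q c = t"
      "(g, \<one>\<^bsub>A\<^esub>) \<otimes>\<^bsub>E\<^esub> (h, \<one>\<^bsub>A\<^esub>) \<otimes>\<^bsub>E\<^esub> inv\<^bsub>E\<^esub> (g, \<one>\<^bsub>A\<^esub>) \<otimes>\<^bsub>E\<^esub> inv\<^bsub>E\<^esub> (h, \<one>\<^bsub>A\<^esub>) = (\<one>, c)"
      using comm[OF t(1,2) A.one_closed A.one_closed] unfolding t(3)[symmetric] by blast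
    have "(\<one>, c) \<in> ?D" unfolding c(3)[symmetric]
      by (rule E.commutator_in_derived) (use t in simp_all)
    thus "t \<in> ?q ` V" using c by (auto simp: V_def)
  qed
  hence gen: "generate ?B ?T \<subseteq> ?q ` V"
    by (intro B.generate_subgroup_incl q.subgroup_img_is_subgroup[OF sV])
  show ?thesis
  proof
    have "subgroup (generate ?B ?T) ?B" by (rule B.generate_is_subgroup[OF T])
    hence W: "subgroup (Pair \<one> ` {a \<in> carrier A. ?q a \<in> generate ?B ?T}) E"
      by (intro emb.subgroup_img_is_subgroup q.subgroup_preimage)
    show "?D \<subseteq> Pair \<one> ` {a \<in> carrier A. ?q a \<in> generate ?B ?T}"
    proof (rule E.derived_subsetI[OF W])
      fix x y assume "x \<in> N \<times> carrier A" "y \<in> N \<times> carrier A"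
      then obtain g a h b where m: "g \<in> N" "a \<in> carrier A" "h \<in> N" "b \<in> carrier A"
        and xy: "x = (g, a)" "y = (h, b)" by blast
      obtain c where c: "c \<in> carrier A" "?q c = ?q (\<delta> g h) \<otimes>\<^bsub>?B\<^esub> inv\<^bsub>?B\<^esub> ?q (\<delta> h g)"
        "(g, a) \<otimes>\<^bsub>E\<^esub> (h, b) \<otimes>\<^bsub>E\<^esub> inv\<^bsub>E\<^esub> (g, a) \<otimes>\<^bsub>E\<^esub> inv\<^bsub>E\<^esub> (h, b) = (\<one>, c)"
        using comm[OF m(1,3,2,4)] by blast
      have "?q c \<in> generate ?B ?T"
        by (rule generate.incl) (use c(2) m in \<open>auto simp: sigma_def simp del: mult_FactGroup\<close>)
      thus "x \<otimes>\<^bsub>E\<^esub> y \<otimes>\<^bsub>E\<^esub> inv\<^bsub>E\<^esub> x \<otimes>\<^bsub>E\<^esub> inv\<^bsub>E\<^esub> y \<in>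
          Pair \<one> ` {a \<in> carrier A. ?q a \<in> generate ?B ?T}"
        unfolding xy c(3) using c(1) by simp
    qed
    show "Pair \<one> ` {a \<in> carrier A. ?q a \<in> generate ?B ?T} \<subseteq> ?D"
    proof clarify
      fix a assume a: "a \<in> carrier A" "?q a \<in> generate ?B ?T"
      then obtain v where v: "v \<in> V" "?q a = ?q v" using gen by blast
      have "a \<in> ?q v" using A.rcos_self[OF a(1) sU] v(2) by simp
      then obtain u where u: "u \<in> U" "a = u \<otimes>\<^bsub>A\<^esub> v"
        by (auto simp: r_coset_def)
      have "a \<in> V" unfolding u(2) using u(1) UV v(1) by (intro subgroup.m_closed[OF sV]) auto
      thus "(\<one>, a) \<in> ?D" by (simp add: V_def)
    qed
  qed
qed

section \<open>The derived series of the extension\<close>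

text \<open>Being abelian and nontrivial, \<open>?K\<close> is the smallest nontrivial term as soon
  as it is a term at all; the only possible index is one past that of
  \<open>gamma G\<close>.\<close>

lemma derived_series_extension_iff:
  assumes sol: "solvable G" "carrier G \<noteq> {\<one>}" and A: "carrier A \<noteq> {\<one>\<^bsub>A\<^esub>}"
  shows "derived_series_extension G A act \<delta> \<longleftrightarrow>
    derived E (gamma G \<times> carrier A) = extension_kernel G A" (is "_ \<longleftrightarrow> ?D = ?K")
proof -
  let ?d = "\<lambda>n. (derived E ^^ n) (carrier E)" and ?g = "\<lambda>n. (derived G ^^ n) (carrier G)"
  interpret proj: group_hom E G fst by (rule proj_group_hom)
  interpret emb: group_hom A E "Pair \<one>" by (rule emb_group_hom)
  interpret gam: subgroup "gamma G" G by (rule comm_group_gamma_group(1)[OF group_axioms sol])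
  note ab = comm_group_gamma_group(2)[OF group_axioms sol, unfolded gamma_group_def]
  have sm: "is_smallest_derived_term G (gamma G)"
    by (rule is_smallest_derived_term_gamma[OF group_axioms sol])
  then obtain n where n: "gamma G = ?g n" and ne: "gamma G \<noteq> {\<one>}"
    by (auto simp: is_smallest_derived_term_def nontrivial_derived_terms_def)
  have dE: "subgroup (?d m) E" for m
    by (rule E.exp_of_derived_is_subgroup[OF E.subgroup_self])
  have "?d (Suc m) \<subseteq> ?d m" for m
    using E.derived_incl[OF order.refl dE[of m]] by simp
  hence dec: "?d j \<subseteq> ?d i" if "i \<le> j" for i j
    using that by (rule lift_Suc_antimono_le)
  have "?g (Suc m) \<subseteq> ?g m" for m
    using derived_incl[OF order.refl exp_of_derived_is_subgroup[OF subgroup_self, of m]] by simp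
  hence decG: "?g j \<subseteq> ?g i" if "i \<le> j" for i j
    using that by (rule lift_Suc_antimono_le)
  have DK: "?D \<subseteq> ?K"
    using derived_preimage_eq[OF gam.subgroup_axioms ab HOL.refl] by (auto simp: extension_kernel_eq)
  have nE: "?d n \<subseteq> gamma G \<times> carrier A"
  proof
    fix x assume x: "x \<in> ?d n"
    hence "x \<in> carrier E" "fst x \<in> gamma G"
      using subgroup.subset[OF dE] proj_derived[of n] n by blast+
    thus "x \<in> gamma G \<times> carrier A" by (auto simp: carrier_extension)
  qed
  hence sucD: "?d (Suc n) \<subseteq> ?D" by (simp add: E.mono_derived)
  have K_ne: "?K \<noteq> {\<one>\<^bsub>E\<^esub>}"
  proof
    assume K: "?K = {\<one>\<^bsub>E\<^esub>}"
    have "a = \<one>\<^bsub>A\<^esub>" if a: "a \<in> carrier A" for a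
    proof -
      have "(\<one>, a) \<in> ?K" using a by (simp add: extension_kernel_def)
      thus ?thesis unfolding K extension_one by blast
    qed
    thus False using A A.one_closed by blast
  qed
  show ?thesis
  proof
    assume "derived_series_extension G A act \<delta>"
    then obtain m where m: "?K = ?d m"
      by (auto simp: derived_series_extension_def is_smallest_derived_term_def nontrivial_derived_terms_def)
    \<comment> \<open>The kernel projects to the trivial subgroup, while \<open>?g j\<close> is
      nontrivial for \<open>j \<le> n\<close>; so \<open>m\<close> is at least
      \<open>Suc n\<close>.\<close>
    have "?g m = {\<one>}"
      using proj_derived[of m] A.one_closed unfolding m[symmetric] extension_kernel_eq image_image
      by auto
    hence "\<not> m \<le> n" using decG[of m n] ne gam.one_closed unfolding n by blast
    hence "?K \<subseteq> ?d (Suc n)" unfolding m by (intro dec) simp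
    thus "?D = ?K" using DK sucD by blast
  next
    assume D: "?D = ?K"
    \<comment> \<open>The bound is \<open>Suc n\<close> because passing from \<open>j\<close> to
      \<open>Suc j\<close> needs \<open>?g n \<subseteq> ?g j\<close>, hence
      \<open>j \<le> n\<close>.\<close>
    have K_sub: "?K \<subseteq> ?d j" if "j \<le> Suc n" for j
      using that
    proof (induction j)
      case 0
      show ?case by (auto simp: extension_kernel_eq carrier_extension)
    next
      case (Suc j)
      have "gamma G \<times> carrier A \<subseteq> ?d j"
      proof clarify
        fix g a assume g: "g \<in> gamma G" and a: "a \<in> carrier A"
        hence "g \<in> fst ` ?d j"
          using proj_derived[of j] decG[of j n] n Suc.prems by auto
        then obtain b where b: "(g, b) \<in> ?d j" by force
        hence E: "(g, b) \<in> carrier E" using subgroup.subset[OF dE] by blast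
        hence gb: "g \<in> carrier G" "b \<in> carrier A" by (auto simp: carrier_extension)
        have aE: "(g, a) \<in> carrier E" using gb a by (simp add: carrier_extension)
        \<comment> \<open>This quotient lies over \<open>\<one>\<close>, hence in \<open>?K\<close>,
          which the induction hypothesis puts into \<open>?d j\<close>; multiplied by
          \<open>(g, b)\<close> it gives \<open>(g, a)\<close>.\<close>
        let ?z = "(g, a) \<otimes>\<^bsub>E\<^esub> inv\<^bsub>E\<^esub> (g, b)"
        have "?z \<in> carrier E" "fst ?z = \<one>" using E aE gb by simp_all
        hence "?z \<in> ?K" by (cases ?z) (auto simp: extension_kernel_eq carrier_extension)
        hence "?z \<in> ?d j" using Suc by auto
        hence "?z \<otimes>\<^bsub>E\<^esub> (g, b) \<in> ?d j" by (rule subgroup.m_closed[OF dE _ b])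
        thus "(g, a) \<in> ?d j" using E aE by (simp add: E.m_assoc)
      qed
      hence "?D \<subseteq> ?d (Suc j)" by (simp add: E.mono_derived)
      thus ?case using D by simp
    qed
    hence K: "?d (Suc n) = ?K" using sucD DK by blast
    \<comment> \<open>\<open>?K\<close> is an image of the abelian group \<open>A\<close>, so the
      series becomes trivial right after it.\<close>
    have "derived E ?K = {\<one>\<^bsub>E\<^esub>}"
      using emb.derived_img[of "carrier A"] A.derived_eq_singleton[of "carrier A"]
      by (simp add: extension_kernel_eq)
    hence triv: "?d (Suc (Suc n)) = {\<one>\<^bsub>E\<^esub>}" using K by simp
    have "?K \<subseteq> L" if L: "L \<in> nontrivial_derived_terms E" for L
    proof -
      obtain m where m: "L = ?d m" "L \<noteq> {\<one>\<^bsub>E\<^esub>}"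
        using L by (auto simp: nontrivial_derived_terms_def)
      have "m \<le> Suc n"
      proof (rule ccontr)
        assume "\<not> m \<le> Suc n"
        hence "L \<subseteq> {\<one>\<^bsub>E\<^esub>}" using dec[of "Suc (Suc n)" m] triv m(1) by simp
        thus False using m subgroup.one_closed[OF dE] by blast
      qed
      thus ?thesis using K_sub m by simp
    qed
    thus "derived_series_extension G A act \<delta>"
      using K K_ne unfolding derived_series_extension_def is_smallest_derived_term_def
        nontrivial_derived_terms_def by blast
  qed
qed

end

theorem theorem9:
  fixes G :: "('a, 'm) monoid_scheme" and A :: "('b, 'n) monoid_scheme"
    and act :: "'b \<Rightarrow> 'a \<Rightarrow> 'b" and \<delta> :: "'a \<Rightarrow> 'a \<Rightarrow> 'b" and U :: "'b set"
  assumes "right_module G A act"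
    and "solvable G" and "carrier G \<noteq> {\<one>\<^bsub>G\<^esub>}"
    and "carrier A \<noteq> {\<one>\<^bsub>A\<^esub>}"
    and "\<delta> \<in> cocycles2 G A act"
    and "U = module_commutator A act (gamma G)"
  shows "derived_series_extension G A act \<delta> \<longleftrightarrow>
    kappa (gamma_group G) (A Mod U) (sigma A U \<delta>) ` carrier (schur_multiplier (gamma_group G))
      = carrier (A Mod U)"
proof -
  interpret module_extension G A act \<delta>
    using assms(1,5) by (simp add: module_extension_def module_extension_axioms_def)
  interpret gam: subgroup "gamma G" G by (rule comm_group_gamma_group(1)[OF is_group assms(2,3)])
  have ab: "comm_group (gamma_group G)" by (rule comm_group_gamma_group(2)[OF is_group assms(2,3)])
  note s = sigma_cocycle[OF assms(1,2,3,5,6)]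
  interpret B: comm_group "A Mod U" by (rule s(2))
  define S where "S = kappa (gamma_group G) (A Mod U) (sigma A U \<delta>) ` carrier (schur_multiplier (gamma_group G))"
  have S: "S = generate (A Mod U)
      {sigma A U \<delta> g h \<otimes>\<^bsub>A Mod U\<^esub> inv\<^bsub>A Mod U\<^esub> sigma A U \<delta> h g | g h. g \<in> gamma G \<and> h \<in> gamma G}"
    using kappa_image[OF ab s(2,3)] by (simp add: S_def gamma_group_def)
  have "S \<subseteq> carrier (A Mod U)"
    using kappa_hom(1)[OF ab s(2,3)] by (auto simp: S_def hom_def)
  \<comment> \<open>Elements of \<open>A Mod U\<close> are cosets, so surjectivity means that the
    preimage of \<open>S\<close> in \<open>A\<close> is everything.\<close>
  hence "S = carrier (A Mod U) \<longleftrightarrow> (\<forall>a\<in>carrier A. U #>\<^bsub>A\<^esub> a \<in> S)"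
    by (auto simp: carrier_FactGroup)
  \<comment> \<open>The derived subgroup is the embedded preimage of \<open>S\<close>, and the
    kernel is the embedded \<open>carrier A\<close>; the embedding is injective.\<close>
  also have "\<dots> \<longleftrightarrow> derived E (gamma G \<times> carrier A) = extension_kernel G A"
    unfolding derived_preimage_eq[OF gam.subgroup_axioms ab[unfolded gamma_group_def] assms(6)] S[symmetric] extension_kernel_eq
    by auto
  also have "\<dots> \<longleftrightarrow> derived_series_extension G A act \<delta>"
    using derived_series_extension_iff[OF assms(2-4)] by simp
  finally show ?thesis unfolding S_def by simp
qed

end
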